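(* Fix a level $l\in\{0,\dots,L\}$ and let $u_{j,l}^n$, $j=1,\dots,J_l$, $n=0,\dots,N_l$, be produced by the ensemble scheme described in the context, with homogeneous Dirichlet boundary condition. Suppose: (i) there is a constant $\theta>0$ with $P\{\omega\in\Omega:\ \min_{\mathbf{x}\in\overline{D}}a(\omega,\mathbf{x})>\theta\}=1$; (ii) there is a constant $\theta_+>0$ such that, for $l=0,\dots,L$, $P\{\omega_j\in\Omega:\ |a(\omega_j,\mathbf{x})-\overline{a}_l|_{\infty}\le\theta_+\}=1$. Then the scheme is stable provided that $\theta>3\theta_+$. Furthermore, under this condition, the numerical solution satisfies, for each $j$, $$ \begin{aligned} &\tfrac14\mathbb{E}\big[\|u_{j,l}^{N_l}\|^2\big]+\tfrac14\mathbb{E}\big[\|2u_{j,l}^{N_l}-u_{j,l}^{N_l-1}\|^2\big]+\tfrac{\theta}{2}\Delta t_l\,\mathbb{E}\big[\|\nabla u_{j,l}^{N_l}\|^2\big]+\Big(\tfrac{\theta}{3}-\theta_+\Big)\Delta t_l\sum_{n=1}^{N_l-1}\mathbb{E}\big[\|\nabla u_{j,l}^n\|^2\big]\\ &\le \frac{\Delta t_l}{2(\theta-3\theta_+)}\sum_{n=1}^{N_l-1}\mathbb{E}\big[\|f_j^{n+1}\|_{-1}^2\big]+\tfrac14\mathbb{E}\big[\|u_{j,l}^1\|^2\big]+\tfrac14\mathbb{E}\big[\|2u_{j,l}^1-u_{j,l}^0\|^2\big]\\ &\quad+\tfrac{\theta}{2}\Delta t_l\,\mathbb{E}\big[\|\nabla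 u_{j,l}^1\|^2\big]+\tfrac{\theta}{6}\Delta t_l\,\mathbb{E}\big[\|\nabla u_{j,l}^0\|^2\big]. \end{aligned} $$
   Context: Problem. $D\subset\mathbb{R}^d$ is a bounded polygonal/polyhedral Lipschitz domain, $(\Omega,\mathcal{F},P)$ a complete probability space with expectation $\mathbb{E}$, $T>0$. The random parabolic problem is: find $u:\Omega\times\overline{D}\times[0,T]\to\mathbb{R}$ satisfying almost surely $u_t-\nabla\cdot[a(\omega,\mathbf{x})\nabla u]=f(\omega,\mathbf{x},t)$ in $D\times[0,T]$, $u=0$ on $\partial D\times[0,T]$, $u(\omega,\mathbf{x},0)=u^0(\omega,\mathbf{x})$ in $D$. Here $a:\Omega\times D\to\mathbb{R}$ and $f:\Omega\times D\times[0,T]\to\mathbb{R}$ are random fields with continuous and bounded covariance functions. Norms. $\|\cdot\|$, $(\cdot,\cdot)$ are the $L^2(D)$ norm and inner product; $|\cdot|_\infty$ is the $L^\infty(D)$ norm; $\|f\|_{-1}=\sup_{0\ne v\in H_0^1(D)}(f,v)/\|\nabla v\|$. Discretization. $\{\mathcal{T}_l\}_{l=0}^L$ is a sequence of quasi-uniform, shape-regular triangular/tetrahedral meshes of $D$ obtained by uniform refinement, with mesh sizes $h_l=\max_{K\in\mathcal{T}_l}\mathrm{diam}\,K=2^{-l}h_0$. For a non-negative integer $m$, $V_l^0=\{v\in H_0^1(D): v|_K$ is a polynomial of degree $m$ (at most $m$) for all $K\in\mathcal{T}_l\}$. At level $l$ the time step is $\Delta t_l=T/N_l$, $t_n=n\Delta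 t_l$. A set of $J_l$ independent, identically distributed samples $\omega_1,\dots,\omega_{J_l}$ is taken; $a_j=a(\omega_j,\cdot)$, $f_j=f(\omega_j,\cdot,\cdot)$, $f_j^n=f_j(t_n)$, $u_j=u(\omega_j,\cdot,\cdot)$, and $\overline{a}_l=\frac1{J_l}\sum_{j=1}^{J_l}a(\omega_j,\mathbf{x})$. Ensemble scheme at level $l$. For $j=1,\dots,J_l$, given $u_{j,l}^0,u_{j,l}^1\in V_l^0$ (approximations of $u_j(t_0),u_j(t_1)$), find $u_{j,l}^{n+1}\in V_l^0$, $n=1,\dots,N_l-1$, such that for all $v_l\in V_l^0$ $$\Big(\frac{3u_{j,l}^{n+1}-4u_{j,l}^n+u_{j,l}^{n-1}}{2\Delta t_l},v_l\Big)+(\overline{a}_l\nabla u_{j,l}^{n+1},\nabla v_l)=-\big((a_j-\overline{a}_l)\nabla(2u_{j,l}^n-u_{j,l}^{n-1}),\nabla v_l\big)+(f_j^{n+1},v_l).$$ Standing assumptions. The exact solution is smooth enough, in particular $u_j\in L^2_P(\Omega;L^2(0,T;H_0^1(D)\cap H^{m+1}(D)))\cap L^2_P(\Omega;H^1(0,T;H^{m+1}(D)))\cap L^2_P(\Omega;H^2(0,T;L^2(D)))$, and $f_j\in L^2_P(\Omega;L^2(0,T;H^{-1}(D)))$. *)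

theory Defs
  imports "HOL-Probability.Probability"
begin

text \<open>Functions on \<open>D\<close> are total functions on \<open>real^'d\<close> whose values outside \<open>D\<close>
  are ignored; elements of \<open>L2\<close> are not identified up to null sets.\<close>

definition L2 :: "(real^'d) set \<Rightarrow> (real^'d \<Rightarrow> 'b::euclidean_space) set" where
  "L2 D = {g. g \<in> borel_measurable (lebesgue_on D) \<and> integrable (lebesgue_on D) (\<lambda>x. (norm (g x))\<^sup>2)}"

definition L2_inner :: "(real^'d) set \<Rightarrow> (real^'d \<Rightarrow> 'b::euclidean_space) \<Rightarrow> (real^'d \<Rightarrow> 'b) \<Rightarrow> real" where
  "L2_inner D g h = (LINT x|lebesgue_on D. g x \<bullet> h x)"

definition L2_norm :: "(real^'d) set \<Rightarrow> (real^'d \<Rightarrow> 'b::euclidean_space) \<Rightarrow> real" where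
  "L2_norm D g = sqrt (L2_inner D g g)"

text \<open>By the convention of \<open>esssup\<close>, the value is \<open>\<infinity>\<close> for non-measurable \<open>g\<close>.\<close>

definition Linf_norm :: "(real^'d) set \<Rightarrow> (real^'d \<Rightarrow> real) \<Rightarrow> ennreal" where
  "Linf_norm D g = esssup (lebesgue_on D) (\<lambda>x. ennreal \<bar>g x\<bar>)"

definition partial_deriv :: "'d \<Rightarrow> (real^'d \<Rightarrow> real) \<Rightarrow> real^'d \<Rightarrow> real" where
  "partial_deriv i \<phi> x = frechet_derivative \<phi> (at x) (axis i 1)"

primrec C_k :: "nat \<Rightarrow> (real^'d \<Rightarrow> real) \<Rightarrow> bool" where
  "C_k 0 \<phi> \<longleftrightarrow> continuous_on UNIV \<phi>"
| "C_k (Suc k) \<phi> \<longleftrightarrow> \<phi> differentiable_on UNIV \<and> (\<forall>i. C_k k (partial_deriv i \<phi>))"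

definition test_function :: "(real^'d) set \<Rightarrow> (real^'d \<Rightarrow> real) \<Rightarrow> bool" where
  "test_function D \<phi> \<longleftrightarrow> (\<forall>k. C_k k \<phi>) \<and>
     compact (closure {x. \<phi> x \<noteq> 0}) \<and> closure {x. \<phi> x \<noteq> 0} \<subseteq> D"

definition has_weak_gradient :: "(real^'d) set \<Rightarrow> (real^'d \<Rightarrow> real) \<Rightarrow> (real^'d \<Rightarrow> real^'d) \<Rightarrow> bool" where
  "has_weak_gradient D v g \<longleftrightarrow> (\<forall>\<phi>. test_function D \<phi> \<longrightarrow>
     (\<forall>i. (LINT x|lebesgue_on D. v x * partial_deriv i \<phi> x) =
          - (LINT x|lebesgue_on D. g x $ i * \<phi> x)))"

definition H1 :: "(real^'d) set \<Rightarrow> (real^'d \<Rightarrow> real) set" where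
  "H1 D = {v \<in> L2 D. \<exists>g \<in> L2 D. has_weak_gradient D v g}"

text \<open>The weak gradient of a function in \<open>H1 D\<close>; it is determined up to a null set of \<open>D\<close>.\<close>

definition weak_grad :: "(real^'d) set \<Rightarrow> (real^'d \<Rightarrow> real) \<Rightarrow> real^'d \<Rightarrow> real^'d" where
  "weak_grad D v = (SOME g. g \<in> L2 D \<and> has_weak_gradient D v g)"

definition H1_0 :: "(real^'d) set \<Rightarrow> (real^'d \<Rightarrow> real) set" where
  "H1_0 D = {v \<in> H1 D. \<exists>\<phi>. (\<forall>k::nat. test_function D (\<phi> k)) \<and>
     (\<lambda>k. L2_norm D (\<lambda>x. v x - \<phi> k x)) \<longlonglongrightarrow> 0 \<and>
     (\<lambda>k. L2_norm D (\<lambda>x. weak_grad D v x - weak_grad D (\<phi> k) x)) \<longlonglongrightarrow> 0}"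

text \<open>The dual norm, with values in \<open>[0, \<infinity>]\<close>. Here \<open>v \<noteq> 0\<close> is meant in \<open>L2\<close>, that is, up to
  null sets. Truncating negative quotients by \<open>ennreal\<close> does not change the supremum, because \<open>v\<close>
  can be replaced by \<open>-v\<close>.\<close>

definition Hm1_norm :: "(real^'d) set \<Rightarrow> (real^'d \<Rightarrow> real) \<Rightarrow> ennreal" where
  "Hm1_norm D g = (SUP v \<in> {v \<in> H1_0 D. \<not> (AE x in lebesgue_on D. v x = 0)}.
     ennreal (L2_inner D g v / L2_norm D (weak_grad D v)))"

text \<open>Functions \<open>g\<close> for which \<open>v \<mapsto> (g, v)\<close> is a bounded linear functional on \<open>H1_0 D\<close>. The
  integrability condition excludes that \<open>(g, v)\<close> is 0 merely by the convention for
  divergent integrals.\<close>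

definition Hm1 :: "(real^'d) set \<Rightarrow> (real^'d \<Rightarrow> real) set" where
  "Hm1 D = {g. g \<in> borel_measurable (lebesgue_on D) \<and>
     (\<forall>v \<in> H1_0 D. integrable (lebesgue_on D) (\<lambda>x. g x * v x)) \<and> Hm1_norm D g < \<infinity>}"

text \<open>Near each boundary point the domain is, in a direction \<open>e\<close>, the strict epigraph of a
  Lipschitz function of the coordinates orthogonal to \<open>e\<close>.\<close>

definition lipschitz_domain :: "(real^'d) set \<Rightarrow> bool" where
  "lipschitz_domain D \<longleftrightarrow> open D \<and> connected D \<and> bounded D \<and> D \<noteq> {} \<and>
     (\<forall>x \<in> frontier D. \<exists>U e \<phi> C. open U \<and> x \<in> U \<and> norm e = 1 \<and> C-lipschitz_on UNIV \<phi> \<and>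
        D \<inter> U = {y \<in> U. \<phi> (y - (y \<bullet> e) *\<^sub>R e) < y \<bullet> e})"

definition polyhedral_lipschitz_domain :: "(real^'d) set \<Rightarrow> bool" where
  "polyhedral_lipschitz_domain D \<longleftrightarrow> lipschitz_domain D \<and>
     (\<exists>\<P>. finite \<P> \<and> (\<forall>P \<in> \<P>. polytope P) \<and> closure D = \<Union>\<P>)"

definition simplicial_mesh :: "(real^'d) set \<Rightarrow> (real^'d) set set \<Rightarrow> bool" where
  "simplicial_mesh D \<T> \<longleftrightarrow> triangulation \<T> \<and> (\<forall>K \<in> \<T>. int CARD('d) simplex K) \<and> \<Union>\<T> = closure D"

definition mesh_size :: "(real^'d) set set \<Rightarrow> real" where
  "mesh_size \<T> = Max (diameter ` \<T>)"

text \<open>Every element is subdivided into \<open>2 ^ d\<close> elements of equal volume, as in the regular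
  refinement of triangles and tetrahedra through the midpoints of the edges.\<close>

definition uniform_refinement :: "(real^'d) set set \<Rightarrow> (real^'d) set set \<Rightarrow> bool" where
  "uniform_refinement \<T> \<T>' \<longleftrightarrow> (\<forall>K \<in> \<T>.
     K = \<Union>{K' \<in> \<T>'. K' \<subseteq> K} \<and> card {K' \<in> \<T>'. K' \<subseteq> K} = 2 ^ CARD('d) \<and>
     (\<forall>K' \<in> \<T>'. K' \<subseteq> K \<longrightarrow> measure lebesgue K' = measure lebesgue K / 2 ^ CARD('d)))"

definition mesh_hierarchy :: "(real^'d) set \<Rightarrow> nat \<Rightarrow> (nat \<Rightarrow> (real^'d) set set) \<Rightarrow> bool" where
  "mesh_hierarchy D L \<T> \<longleftrightarrow>
     (\<forall>l\<le>L. simplicial_mesh D (\<T> l)) \<and>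
     (\<forall>l<L. uniform_refinement (\<T> l) (\<T> (Suc l))) \<and>
     (\<forall>l\<le>L. mesh_size (\<T> l) = mesh_size (\<T> 0) / 2 ^ l) \<and>
     (\<exists>\<kappa>>0. \<forall>l\<le>L. \<forall>K \<in> \<T> l. mesh_size (\<T> l) \<le> \<kappa> * diameter K) \<and>
     (\<exists>\<kappa>>0. \<forall>l\<le>L. \<forall>K \<in> \<T> l. \<exists>x r. 0 < r \<and> cball x r \<subseteq> K \<and> diameter K \<le> \<kappa> * r)"

definition poly_deg_le :: "nat \<Rightarrow> (real^'d \<Rightarrow> real) \<Rightarrow> bool" where
  "poly_deg_le m p \<longleftrightarrow> (\<exists>c. \<forall>x. p x =
     (\<Sum>\<alpha> \<in> {\<alpha> :: 'd \<Rightarrow> nat. (\<Sum>i\<in>UNIV. \<alpha> i) \<le> m}. c \<alpha> * (\<Prod>i\<in>UNIV. (x $ i) ^ \<alpha> i)))"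

definition fe_space :: "(real^'d) set \<Rightarrow> (real^'d) set set \<Rightarrow> nat \<Rightarrow> (real^'d \<Rightarrow> real) set" where
  "fe_space D \<T> m = {v \<in> H1_0 D. \<forall>K \<in> \<T>. \<exists>p. poly_deg_le m p \<and> (\<forall>x\<in>K. v x = p x)}"

text \<open>Expectation of a nonnegative random variable, with values in \<open>[0, \<infinity>]\<close>.\<close>

definition Expect :: "'s measure \<Rightarrow> ('s \<Rightarrow> ennreal) \<Rightarrow> ennreal" where
  "Expect Q X = (\<integral>\<^sup>+ s. X s \<partial>Q)"

definition covariance :: "'w measure \<Rightarrow> ('w \<Rightarrow> real) \<Rightarrow> ('w \<Rightarrow> real) \<Rightarrow> real" where
  "covariance M X Y =
     integral\<^sup>L M (\<lambda>\<omega>. (X \<omega> - integral\<^sup>L M X) * (Y \<omega> - integral\<^sup>L M Y))"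

definition continuous_bounded_covariance ::
    "'w measure \<Rightarrow> 'i::metric_space set \<Rightarrow> ('w \<Rightarrow> 'i \<Rightarrow> real) \<Rightarrow> bool" where
  "continuous_bounded_covariance M I X \<longleftrightarrow>
     (\<forall>p \<in> I. (\<lambda>\<omega>. X \<omega> p) \<in> borel_measurable M \<and> integrable M (\<lambda>\<omega>. (X \<omega> p)\<^sup>2)) \<and>
     continuous_on (I \<times> I) (\<lambda>(p, q). covariance M (\<lambda>\<omega>. X \<omega> p) (\<lambda>\<omega>. X \<omega> q)) \<and>
     bounded ((\<lambda>(p, q). covariance M (\<lambda>\<omega>. X \<omega> p) (\<lambda>\<omega>. X \<omega> q)) ` (I \<times> I))"

text \<open>Almost sure essential boundedness makes the form \<open>(a \<nabla>v, \<nabla>w)\<close> well defined on \<open>H1_0 D\<close>.\<close>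

definition random_coefficient ::
    "'w measure \<Rightarrow> (real^'d) set \<Rightarrow> ('w \<Rightarrow> real^'d \<Rightarrow> real) \<Rightarrow> bool" where
  "random_coefficient M D a \<longleftrightarrow>
     (\<lambda>(\<omega>, x). a \<omega> x) \<in> borel_measurable (M \<Otimes>\<^sub>M restrict_space borel D) \<and>
     continuous_bounded_covariance M D a \<and>
     (AE \<omega> in M. Linf_norm D (a \<omega>) < \<infinity>)"

text \<open>The last three conditions express that \<open>f\<close> lies in \<open>L\<^sup>2(\<Omega>; L\<^sup>2(0, T; H\<^sup>-\<^sup>1(D)))\<close>. The scheme
  uses the values of \<open>f\<close> at the time nodes, so membership in \<open>H\<^sup>-\<^sup>1(D)\<close> is required for each time
  rather than for almost every time.\<close>

definition random_source ::
    "'w measure \<Rightarrow> (real^'d) set \<Rightarrow> real \<Rightarrow> ('w \<Rightarrow> real^'d \<Rightarrow> real \<Rightarrow> real) \<Rightarrow> bool" where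
  "random_source M D T f \<longleftrightarrow>
     (\<lambda>(\<omega>, x, t). f \<omega> x t) \<in> borel_measurable
        (M \<Otimes>\<^sub>M restrict_space borel D \<Otimes>\<^sub>M restrict_space borel {0..T}) \<and>
     continuous_bounded_covariance M (D \<times> {0..T}) (\<lambda>\<omega> (x, t). f \<omega> x t) \<and>
     (\<forall>t \<in> {0..T}. AE \<omega> in M. (\<lambda>x. f \<omega> x t) \<in> Hm1 D) \<and>
     (\<lambda>(\<omega>, t). Hm1_norm D (\<lambda>x. f \<omega> x t)) \<in>
        borel_measurable (M \<Otimes>\<^sub>M restrict_space borel {0..T}) \<and>
     Expect M (\<lambda>\<omega>. \<integral>\<^sup>+ t \<in> {0..T}. (Hm1_norm D (\<lambda>x. f \<omega> x t))\<^sup>2 \<partial>lborel) < \<infinity>"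

text \<open>The samples are random elements of \<open>M\<close> defined on a probability space \<open>Q\<close>; a solution of
  the ensemble scheme depends on all of them.\<close>

definition iid_samples :: "'s measure \<Rightarrow> 'w measure \<Rightarrow> nat \<Rightarrow> (nat \<Rightarrow> 's \<Rightarrow> 'w) \<Rightarrow> bool" where
  "iid_samples Q M J \<xi> \<longleftrightarrow> prob_space.indep_vars Q (\<lambda>_. M) \<xi> {1..J} \<and>
     (\<forall>j \<in> {1..J}. distr Q M (\<xi> j) = M)"

definition min_greater :: "real \<Rightarrow> (real^'d \<Rightarrow> real) \<Rightarrow> (real^'d) set \<Rightarrow> bool" where
  "min_greater c g S \<longleftrightarrow> (\<exists>x\<in>S. (\<forall>y\<in>S. g x \<le> g y) \<and> g x > c)"

definition ens_mean :: "nat \<Rightarrow> (nat \<Rightarrow> real^'d \<Rightarrow> real) \<Rightarrow> real^'d \<Rightarrow> real" where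
  "ens_mean J A x = (1 / real J) * (\<Sum>j=1..J. A j x)"

text \<open>One realization of the scheme, for coefficients \<open>A j\<close>, sources \<open>F j n\<close> at the time nodes and
  iterates \<open>U j n\<close>; the initial values \<open>U j 0\<close> and \<open>U j 1\<close> are arbitrary elements of \<open>V\<close>.\<close>

definition ensemble_solution ::
    "(real^'d) set \<Rightarrow> (real^'d \<Rightarrow> real) set \<Rightarrow> real \<Rightarrow> nat \<Rightarrow> nat \<Rightarrow> (nat \<Rightarrow> real^'d \<Rightarrow> real) \<Rightarrow>
     (nat \<Rightarrow> nat \<Rightarrow> real^'d \<Rightarrow> real) \<Rightarrow> (nat \<Rightarrow> nat \<Rightarrow> real^'d \<Rightarrow> real) \<Rightarrow> bool" where
  "ensemble_solution D V \<tau> N J A F U \<longleftrightarrow> (\<forall>j \<in> {1..J}.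
     (\<forall>n\<le>N. U j n \<in> V) \<and>
     (\<forall>n \<in> {1..<N}. \<forall>v \<in> V.
        L2_inner D (\<lambda>x. (3 * U j (n+1) x - 4 * U j n x + U j (n-1) x) / (2 * \<tau>)) v
        + L2_inner D (\<lambda>x. ens_mean J A x *\<^sub>R weak_grad D (U j (n+1)) x) (weak_grad D v)
        = - L2_inner D (\<lambda>x. (A j x - ens_mean J A x) *\<^sub>R
                weak_grad D (\<lambda>y. 2 * U j n y - U j (n-1) y) x) (weak_grad D v)
          + L2_inner D (F j (n+1)) v))"

end

theory Submission
  imports Defs
begin

text \<open>
  Test the scheme with \<open>v = u\<^sup>n\<^sup>+\<^sup>1\<close>, for one realization of the samples. The
  second-order difference quotient produces the telescoping quantity
  \<open>E\<^sub>n = 1/4 (\<parallel>u\<^sup>n\<parallel>\<^sup>2 + \<parallel>2u\<^sup>n - u\<^sup>n\<^sup>-\<^sup>1\<parallel>\<^sup>2)\<close> plus a square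
  (\<open>L2_inner_BDF2_ge\<close>). The averaged coefficient is at least \<open>\<theta>\<close>, so the implicit term controls
  \<open>\<theta> \<parallel>\<nabla>u\<^sup>n\<^sup>+\<^sup>1\<parallel>\<^sup>2\<close>. The explicit fluctuation term is at most \<open>\<theta>\<^sub>+\<close> times a
  weighted sum, with weights \<open>3/2\<close>, \<open>1\<close>, \<open>1/2\<close>, of the squared gradient norms of \<open>u\<^sup>n\<^sup>+\<^sup>1\<close>,
  \<open>u\<^sup>n\<close>, \<open>u\<^sup>n\<^sup>-\<^sup>1\<close>. As these weights add up to \<open>3\<close>, the condition \<open>\<theta> > 3\<theta>\<^sub>+\<close> lets the
  implicit term win, and the surplus \<open>\<theta> - 3\<theta>\<^sub>+\<close> pays for the source by Young's inequality
  (\<open>ensemble_energy_step\<close>). Summation over the time steps (\<open>BDF2_recursion\<close>) gives the estimate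
  for almost every realization (\<open>ensemble_stability_ennreal\<close>), and integration gives the theorem.

  Three points behind this short computation need work.

  The gradients are arbitrary representatives of weak gradients, so that
  \<open>\<nabla>(2u\<^sup>n - u\<^sup>n\<^sup>-\<^sup>1) = 2\<nabla>u\<^sup>n - \<nabla>u\<^sup>n\<^sup>-\<^sup>1\<close> requires uniqueness almost everywhere
  (\<open>weak_gradient_unique\<close>). A difference of two weak gradients is orthogonal to all test functions;
  smooth bumps that increase to the indicator of a box show that its integral over each small box
  vanishes, and Lebesgue's differentiation theorem shows that it vanishes itself.

  The dual norm of the source is a supremum of quotients, in which division by \<open>0\<close> yields \<open>0\<close>. The
  bound \<open>(f, v) \<le> \<parallel>f\<parallel>\<^sub>-\<^sub>1 \<parallel>\<nabla>v\<parallel>\<close> therefore needs that \<open>\<nabla>v = 0\<close> forces \<open>v = 0\<close> on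
  \<open>H1_0 D\<close>. This follows from the Poincare inequality for test functions.

  Sums and expectations may be exchanged only for measurable random variables, but
  \<open>\<parallel>\<nabla>u\<^sup>n\<parallel>\<close> is defined through a choice for each realization. Piecewise polynomials form a
  finite-dimensional space: there are finitely many \<open>e\<^sub>i\<close> in it with \<open>v = \<Sum>\<^sub>i (v, e\<^sub>i) e\<^sub>i\<close>
  almost everywhere for all its elements \<open>v\<close> (\<open>reproducing_family\<close>). Hence
  \<open>\<parallel>\<nabla>v\<parallel>\<^sup>2\<close> is a fixed quadratic polynomial in the numbers \<open>(v, e\<^sub>i)\<close>, and these depend
  measurably on the realization (\<open>measurable_gradient_norm_square\<close>).
\<close>

section \<open>Square-integrable functions\<close>

lemma L2_measurable: "g \<in> L2 D \<Longrightarrow> g \<in> borel_measurable (lebesgue_on D)"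
  by (simp add: L2_def)

lemma L2_square_integrable: "g \<in> L2 D \<Longrightarrow> integrable (lebesgue_on D) (\<lambda>x. (norm (g x))\<^sup>2)"
  by (simp add: L2_def)

lemma integrable_product_of_squares:
  fixes g h :: "'a \<Rightarrow> real"
  assumes "g \<in> borel_measurable M" "h \<in> borel_measurable M"
    and "integrable M (\<lambda>x. (g x)\<^sup>2)" "integrable M (\<lambda>x. (h x)\<^sup>2)"
  shows "integrable M (\<lambda>x. g x * h x)"
proof (rule Bochner_Integration.integrable_bound[where f = "\<lambda>x. (g x)\<^sup>2 + (h x)\<^sup>2"])
  show "integrable M (\<lambda>x. (g x)\<^sup>2 + (h x)\<^sup>2)" "(\<lambda>x. g x * h x) \<in> borel_measurable M"
    using assms by auto
  have "\<bar>u * v\<bar> \<le> u\<^sup>2 + v\<^sup>2" for u v :: real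
    using sum_squares_bound[of "\<bar>u\<bar>" "\<bar>v\<bar>"] mult_nonneg_nonneg[OF abs_ge_zero[of u] abs_ge_zero[of v]]
    unfolding abs_mult power2_abs by linarith
  then show "AE x in M. norm (g x * h x) \<le> norm ((g x)\<^sup>2 + (h x)\<^sup>2)"
    by simp
qed

lemma integrable_L2_inner:
  assumes "g \<in> L2 D" "h \<in> L2 D"
  shows "integrable (lebesgue_on D) (\<lambda>x. g x \<bullet> h x)"
proof (rule Bochner_Integration.integrable_bound)
  show "integrable (lebesgue_on D) (\<lambda>x. norm (g x) * norm (h x))"
    using assms by (intro integrable_product_of_squares) (auto simp: L2_def)
  show "(\<lambda>x. g x \<bullet> h x) \<in> borel_measurable (lebesgue_on D)"
    using assms by (auto simp: L2_def)
qed (auto intro: Cauchy_Schwarz_ineq2)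

lemma L2_lincomb:
  assumes "g \<in> L2 D" "h \<in> L2 D"
  shows "(\<lambda>x. \<alpha> *\<^sub>R g x + \<beta> *\<^sub>R h x) \<in> L2 D"
proof -
  have "(norm (\<alpha> *\<^sub>R g x + \<beta> *\<^sub>R h x))\<^sup>2 =
      \<alpha>\<^sup>2 * (norm (g x))\<^sup>2 + 2 * \<alpha> * \<beta> * (g x \<bullet> h x) + \<beta>\<^sup>2 * (norm (h x))\<^sup>2" for x
    unfolding power2_norm_eq_inner
    by (simp add: inner_add_left inner_add_right inner_commute power2_eq_square algebra_simps)
  moreover have "integrable (lebesgue_on D)
     (\<lambda>x. \<alpha>\<^sup>2 * (norm (g x))\<^sup>2 + 2 * \<alpha> * \<beta> * (g x \<bullet> h x) + \<beta>\<^sup>2 * (norm (h x))\<^sup>2)"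
    using assms integrable_L2_inner[OF assms] by (intro Bochner_Integration.integrable_add) (auto simp: L2_def)
  ultimately show ?thesis
    using assms by (auto simp: L2_def)
qed

lemma L2_diff: "g \<in> L2 D \<Longrightarrow> h \<in> L2 D \<Longrightarrow> (\<lambda>x. g x - h x) \<in> L2 D"
  using L2_lincomb[of g D h 1 "-1"] by simp

lemma L2_zero: "(\<lambda>x. 0) \<in> L2 D"
  by (simp add: L2_def)

lemma L2_sum:
  assumes "\<And>i. i \<in> I \<Longrightarrow> g i \<in> L2 D"
  shows "(\<lambda>x. \<Sum>i\<in>I. c i *\<^sub>R g i x) \<in> L2 D"
  using assms
proof (induction I rule: infinite_finite_induct)
  case (insert i I)
  then show ?case
    using L2_lincomb[of "g i" D "\<lambda>x. \<Sum>i\<in>I. c i *\<^sub>R g i x" "c i" 1] by simp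
qed (auto simp: L2_zero)

text \<open>
  Multiplication by an essentially bounded coefficient keeps a gradient in
  \<open>L\<^sup>2\<close>; hence the integrals in the scheme converge, and none of them has
  the value \<open>0\<close> that the Bochner integral assigns to divergent ones.
\<close>

lemma L2_multiplier:
  fixes b :: "real^'d \<Rightarrow> real"
  assumes "b \<in> borel_measurable (lebesgue_on D)" "AE x in lebesgue_on D. \<bar>b x\<bar> \<le> c" "g \<in> L2 D"
  shows "(\<lambda>x. b x *\<^sub>R g x) \<in> L2 D"
proof -
  have "integrable (lebesgue_on D) (\<lambda>x. (norm (b x *\<^sub>R g x))\<^sup>2)"
  proof (rule Bochner_Integration.integrable_bound[where f = "\<lambda>x. c\<^sup>2 * (norm (g x))\<^sup>2"])
    show "AE x in lebesgue_on D. norm ((norm (b x *\<^sub>R g x))\<^sup>2) \<le> norm (c\<^sup>2 * (norm (g x))\<^sup>2)"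
      using assms(2)
    proof eventually_elim
      case (elim x)
      then have "(\<bar>b x\<bar>)\<^sup>2 \<le> c\<^sup>2"
        by (intro power_mono) auto
      then show ?case
        by (simp add: power_mult_distrib mult_right_mono)
    qed
  qed (use assms in \<open>auto simp: L2_def\<close>)
  then show ?thesis
    using assms by (auto simp: L2_def)
qed

lemma L2_component: "g \<in> L2 D \<Longrightarrow> (\<lambda>x. g x $ i) \<in> L2 D" for g :: "real^'d \<Rightarrow> real^'n"
proof -
  assume g: "g \<in> L2 D"
  have m: "(\<lambda>x. g x $ i) \<in> borel_measurable (lebesgue_on D)"
    using borel_measurable_nth L2_measurable[OF g] by measurable
  have "(g x $ i)\<^sup>2 \<le> (norm (g x))\<^sup>2" for x
    using component_le_norm_cart[of "g x" i] by (metis power2_abs abs_ge_zero power_mono)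
  then show ?thesis
    using g m unfolding L2_def mem_Collect_eq
    by (intro conjI Bochner_Integration.integrable_bound[OF L2_square_integrable[OF g]]) auto
qed

lemma L2_inner_commute: "L2_inner D g h = L2_inner D h g"
  by (simp add: L2_inner_def inner_commute)

lemma L2_inner_cong_AE:
  assumes "AE x in lebesgue_on D. g x = g' x" "g \<in> L2 D" "g' \<in> L2 D" "h \<in> L2 D"
  shows "L2_inner D g h = L2_inner D g' h"
  unfolding L2_inner_def
proof (rule integral_cong_AE)
  show "AE x in lebesgue_on D. g x \<bullet> h x = g' x \<bullet> h x"
    using assms(1) by eventually_elim simp
qed (use assms in \<open>auto simp: L2_def\<close>)

lemma L2_inner_lincomb_left:
  assumes "g \<in> L2 D" "g' \<in> L2 D" "h \<in> L2 D"
  shows "L2_inner D (\<lambda>x. \<alpha> *\<^sub>R g x + \<beta> *\<^sub>R g' x) h = \<alpha> * L2_inner D g h + \<beta> * L2_inner D g' h"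
  using assms by (simp add: L2_inner_def inner_add_left integrable_L2_inner)

lemma L2_inner_sum_left:
  assumes "\<And>i. i \<in> I \<Longrightarrow> g i \<in> L2 D" "h \<in> L2 D"
  shows "L2_inner D (\<lambda>x. \<Sum>i\<in>I. c i *\<^sub>R g i x) h = (\<Sum>i\<in>I. c i * L2_inner D (g i) h)"
  using assms by (simp add: L2_inner_def inner_sum_left integrable_L2_inner)

lemma L2_inner_self_nonneg: "0 \<le> L2_inner D g g"
  unfolding L2_inner_def by (rule Bochner_Integration.integral_nonneg) simp

lemma L2_norm_square: "(L2_norm D g)\<^sup>2 = L2_inner D g g"
  by (simp add: L2_norm_def L2_inner_self_nonneg)

lemma L2_norm_nonneg: "0 \<le> L2_norm D g"
  by (simp add: L2_norm_def L2_inner_self_nonneg)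

lemma L2_inner_self_eq_0_iff:
  assumes "g \<in> L2 D"
  shows "L2_inner D g g = 0 \<longleftrightarrow> (AE x in lebesgue_on D. g x = 0)"
  unfolding L2_inner_def
  using integral_nonneg_eq_0_iff_AE[OF integrable_L2_inner[OF assms assms]] by simp

section \<open>Smooth bump functions\<close>

text \<open>
  For \<open>p = 1\<close> the classical smooth function with a zero of infinite order at
  \<open>0\<close>; the polynomials keep track of its derivatives.
\<close>

definition flat :: "real poly \<Rightarrow> real \<Rightarrow> real" where
  "flat p t = (if t > 0 then poly p (1 / t) * exp (- (1 / t)) else 0)"

lemma poly_times_exp_minus_tendsto_0: "((\<lambda>y. poly p y * exp (- y)) \<longlongrightarrow> (0::real)) at_top"
proof -
  have "((\<lambda>y. \<Sum>i\<le>degree p. coeff p i * (y ^ i / exp y)) \<longlongrightarrow> (\<Sum>i\<le>degree p. coeff p i * 0)) at_top"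
    by (intro tendsto_sum tendsto_mult tendsto_const tendsto_power_div_exp_0)
  moreover have "(\<Sum>i\<le>degree p. coeff p i * (y ^ i / exp y)) = poly p y * exp (- y)" for y
    by (simp add: poly_altdef sum_distrib_right exp_minus divide_inverse mult.assoc)
  ultimately show ?thesis
    by simp
qed

text \<open>
  The derivatives of \<open>exp (- 1/t)\<close> are again of the form \<open>p (1/t) exp (-
  1/t)\<close>, and the exponential beats the polynomial at \<open>0\<close>. The derivative
  acts on the polynomial as \<open>p \<mapsto> X\<^sup>2 (p - p')\<close>, because
  \<open>1/t\<close> has the derivative \<open>- 1/t\<^sup>2\<close>.
\<close>

lemma flat_derivative: "(flat p has_real_derivative flat ([:0, 0, 1:] * (p - pderiv p)) t) (at t)"
proof -
  consider "t > 0" | "t < 0" | "t = 0" by linarith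
  then show ?thesis
  proof cases
    case 1
    have "((\<lambda>t. poly p (1 / t) * exp (- (1 / t))) has_real_derivative
        flat ([:0, 0, 1:] * (p - pderiv p)) t) (at t)"
      using 1 by (auto intro!: derivative_eq_intros simp: flat_def field_simps power2_eq_square)
    then show ?thesis
      by (rule has_field_derivative_transform_within_open[where S = "{0<..}"])
        (use 1 in \<open>auto simp: flat_def\<close>)
  next
    case 2
    have "((\<lambda>t. 0) has_real_derivative flat ([:0, 0, 1:] * (p - pderiv p)) t) (at t)"
      using 2 by (simp add: flat_def)
    then show ?thesis
      by (rule has_field_derivative_transform_within_open[where S = "{..<0}"])
        (use 2 in \<open>auto simp: flat_def\<close>)
  next
    case 3
    have "filterlim (\<lambda>h. 1 / h) at_top (at_right (0::real))"
      by (simp add: filterlim_inverse_at_top_right flip: inverse_eq_divide)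
    from filterlim_compose[OF poly_times_exp_minus_tendsto_0[of "[:0, 1:] * p"] this]
    have right: "((\<lambda>h. flat p h / h) \<longlongrightarrow> 0) (at_right 0)"
    proof (rule Lim_transform_eventually)
      show "\<forall>\<^sub>F h in at_right 0.
          poly ([:0, 1:] * p) (1 / h) * exp (- (1 / h)) = flat p h / h"
        by (auto simp: eventually_at_filter flat_def)
    qed
    have left: "((\<lambda>h. flat p h / h) \<longlongrightarrow> 0) (at_left 0)"
      by (rule Lim_transform_eventually[OF tendsto_const[of 0]])
        (auto simp: eventually_at_filter flat_def)
    have "((\<lambda>h. flat p h / h) \<longlongrightarrow> 0) (at 0)"
      using left right by (simp add: filterlim_split_at)
    then show ?thesis
      using 3 by (simp add: DERIV_def flat_def)
  qed
qed

text \<open>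
  A class of functions that is closed under partial derivatives, so that differentiability of
  all orders follows by induction on the way a function is built. The affine reparametrization
  of \<open>flat\<close> is what bumps on arbitrary boxes require.
\<close>

inductive smooth_expr :: "(real^'d \<Rightarrow> real) \<Rightarrow> bool" where
  const: "smooth_expr (\<lambda>x. c)"
| flat: "smooth_expr (\<lambda>x. flat p (\<alpha> * x $ i + \<beta>))"
| add: "smooth_expr \<phi> \<Longrightarrow> smooth_expr \<psi> \<Longrightarrow> smooth_expr (\<lambda>x. \<phi> x + \<psi> x)"
| mult: "smooth_expr \<phi> \<Longrightarrow> smooth_expr \<psi> \<Longrightarrow> smooth_expr (\<lambda>x. \<phi> x * \<psi> x)"

lemma partial_deriv_eq:
  "(\<phi> has_derivative \<phi>') (at x) \<Longrightarrow> partial_deriv i \<phi> x = \<phi>' (axis i 1)"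
  unfolding partial_deriv_def by (simp flip: frechet_derivative_at)

lemma has_derivative_frechet:
  "\<phi> differentiable (at x) \<Longrightarrow> (\<phi> has_derivative frechet_derivative \<phi> (at x)) (at x)"
  by (simp add: frechet_derivative_works)

lemma partial_deriv_add:
  assumes "\<phi> differentiable (at x)" "\<psi> differentiable (at x)"
  shows "partial_deriv i (\<lambda>x. \<phi> x + \<psi> x) x = partial_deriv i \<phi> x + partial_deriv i \<psi> x"
  using partial_deriv_eq[OF has_derivative_add[OF assms[THEN has_derivative_frechet]]]
  by (simp add: partial_deriv_def)

lemma partial_deriv_mult:
  assumes "\<phi> differentiable (at x)" "\<psi> differentiable (at x)"
  shows "partial_deriv i (\<lambda>x. \<phi> x * \<psi> x) x =
    \<phi> x * partial_deriv i \<psi> x + partial_deriv i \<phi> x * \<psi> x"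
  using partial_deriv_eq[OF has_derivative_mult[OF assms[THEN has_derivative_frechet]]]
  by (simp add: partial_deriv_def)

text \<open>
  The syntactic class is closed under partial derivatives, which gives derivatives of all
  orders at once.
\<close>

lemma smooth_expr_closed:
  fixes \<phi> :: "real^'d \<Rightarrow> real"
  assumes "smooth_expr \<phi>"
  shows "(\<forall>x. \<phi> differentiable (at x)) \<and> (\<forall>i. smooth_expr (partial_deriv i \<phi>))"
  using assms
proof induction
  case (const c)
  have "partial_deriv i (\<lambda>x::real^'d. c) = (\<lambda>x. 0)" for i
    by (intro ext) (subst partial_deriv_eq[where \<phi>' = "\<lambda>_. 0"], auto)
  then show ?case
    by (simp add: smooth_expr.const)
next
  case (flat p \<alpha> j \<beta>)
  let ?q = "[:0, 0, 1:] * (p - pderiv p)"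
  have d: "((\<lambda>x. flat p (\<alpha> * x $ j + \<beta>)) has_derivative
      (\<lambda>h. \<alpha> * h $ j * flat ?q (\<alpha> * x $ j + \<beta>))) (at x)" for x
    by (rule has_derivative_eq_rhs[OF has_derivative_compose[OF _ flat_derivative[unfolded has_field_derivative_def]]])
      (auto intro!: derivative_eq_intros bounded_linear.has_derivative[OF bounded_linear_vec_nth])
  have "partial_deriv i (\<lambda>x. flat p (\<alpha> * x $ j + \<beta>)) =
      (\<lambda>x. (\<alpha> * axis i 1 $ j) * flat ?q (\<alpha> * x $ j + \<beta>))" for i
    by (intro ext) (subst partial_deriv_eq[OF d], simp)
  then have "smooth_expr (partial_deriv i (\<lambda>x. flat p (\<alpha> * x $ j + \<beta>)))" for i
    by (simp only: smooth_expr.intros)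
  then show ?case
    using d by (auto simp: differentiable_def)
next
  case (add \<phi> \<psi>)
  then have "partial_deriv i (\<lambda>x. \<phi> x + \<psi> x) = (\<lambda>x. partial_deriv i \<phi> x + partial_deriv i \<psi> x)" for i
    by (auto simp: partial_deriv_add)
  then show ?case
    using add.IH by (auto intro: smooth_expr.add)
next
  case (mult \<phi> \<psi>)
  then have "partial_deriv i (\<lambda>x. \<phi> x * \<psi> x) =
      (\<lambda>x. \<phi> x * partial_deriv i \<psi> x + partial_deriv i \<phi> x * \<psi> x)" for i
    by (auto simp: partial_deriv_mult)
  then show ?case
    using mult by (auto intro!: smooth_expr.add smooth_expr.mult)
qed

lemma smooth_expr_C_k: "smooth_expr \<phi> \<Longrightarrow> C_k k \<phi>"
proof (induction k arbitrary: \<phi>)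
  case 0
  then show ?case
    using smooth_expr_closed[of \<phi>]
    by (auto intro!: continuous_at_imp_continuous_on differentiable_imp_continuous_within)
next
  case (Suc k)
  then show ?case
    using smooth_expr_closed[of \<phi>] by (auto simp: differentiable_on_def)
qed

lemma smooth_expr_prod:
  assumes "finite I" "\<And>i. i \<in> I \<Longrightarrow> smooth_expr (\<phi> i)"
  shows "smooth_expr (\<lambda>x. \<Prod>i\<in>I. \<phi> i x)"
  using assms by (induction I rule: finite_induct) (auto intro: smooth_expr.intros)

text \<open>
  A smooth function with values in \<open>[0, 1]\<close> that is positive exactly on
  \<open>box a b\<close>; the larger \<open>r\<close>, the steeper it is at the faces.
\<close>

definition box_bump :: "real \<Rightarrow> real^'d \<Rightarrow> real^'d \<Rightarrow> real^'d \<Rightarrow> real" where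
  "box_bump r a b x = (\<Prod>i\<in>UNIV. flat 1 (r * (x $ i - a $ i)) * flat 1 (r * (b $ i - x $ i)))"

lemma flat_one: "flat 1 t = (if t > 0 then exp (- (1 / t)) else 0)"
  by (simp add: flat_def)

lemma box_bump_bounds: "0 \<le> box_bump r a b x" "box_bump r a b x \<le> 1"
proof -
  have "0 \<le> flat 1 t" "flat 1 t \<le> 1" for t
    by (auto simp: flat_one)
  then show "0 \<le> box_bump r a b x" "box_bump r a b x \<le> 1"
    unfolding box_bump_def by (auto intro!: prod_nonneg prod_le_1 mult_le_one)
qed

lemma box_bump_eq_0_iff: "r > 0 \<Longrightarrow> box_bump r a b x = 0 \<longleftrightarrow> x \<notin> box a b"
  by (auto simp: box_bump_def flat_one mem_box_cart zero_less_mult_iff split: if_splits)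

lemma smooth_expr_box_bump: "smooth_expr (box_bump r a b)"
proof -
  have "smooth_expr (\<lambda>x. \<Prod>i\<in>UNIV. flat 1 (r * x $ i + (- r * a $ i)) * flat 1 ((-r) * x $ i + r * b $ i))"
    by (intro smooth_expr_prod smooth_expr.intros) auto
  moreover have "(\<lambda>x. \<Prod>i\<in>UNIV. flat 1 (r * x $ i + (- r * a $ i)) * flat 1 ((-r) * x $ i + r * b $ i)) = box_bump r a b"
    by (simp add: box_bump_def fun_eq_iff algebra_simps)
  ultimately show ?thesis by simp
qed

lemma box_bump_test_function:
  assumes "r > 0" "cbox a b \<subseteq> D"
  shows "test_function D (box_bump r a b)"
proof -
  have "closure {x. box_bump r a b x \<noteq> 0} \<subseteq> cbox a b"
    using assms(1) by (intro closure_minimal) (auto simp: box_bump_eq_0_iff box_subset_cbox[THEN subsetD])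
  moreover from this have "compact (closure {x. box_bump r a b x \<noteq> 0})"
    by (metis bounded_cbox bounded_subset closed_closure compact_eq_bounded_closed)
  ultimately show ?thesis
    using assms(2) by (auto simp: test_function_def smooth_expr_C_k smooth_expr_box_bump)
qed

text \<open>
  A large \<open>r\<close> makes \<open>exp (- 1/(r t))\<close> close to \<open>1\<close> for
  every \<open>t > 0\<close> while it remains \<open>0\<close> for \<open>t \<le> 0\<close>.
  Taking \<open>k + 1\<close> for \<open>r\<close> keeps it positive.
\<close>

lemma box_bump_tendsto: "(\<lambda>k. box_bump (real (Suc k)) a b x) \<longlonglongrightarrow> indicator (box a b) x"
proof -
  have "(\<lambda>k. flat 1 (real (Suc k) * t)) \<longlonglongrightarrow> (if t > 0 then 1 else 0)" for t
  proof (cases "t > 0")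
    case True
    have "(\<lambda>k. exp (- (inverse (real (Suc k)) * (1 / t)))) \<longlonglongrightarrow> exp (- (0 * (1 / t)))"
      by (intro tendsto_intros LIMSEQ_inverse_real_of_nat)
    moreover have "real (Suc k) * t > 0" for k
      using True by (simp add: zero_less_mult_iff)
    ultimately show ?thesis
      using True by (simp only: flat_one if_True) (simp add: divide_inverse)
  qed (auto simp: flat_one zero_less_mult_iff)
  then have "(\<lambda>k. box_bump (real (Suc k)) a b x) \<longlonglongrightarrow>
      (\<Prod>i\<in>UNIV. (if x $ i - a $ i > 0 then 1 else 0) * (if b $ i - x $ i > 0 then 1 else 0))"
    unfolding box_bump_def by (intro tendsto_prod tendsto_mult)
  also have "(\<Prod>i\<in>UNIV. (if x $ i - a $ i > 0 then 1 else 0) * (if b $ i - x $ i > 0 then 1 else 0)) =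
      (indicator (box a b) x :: real)"
    by (auto simp: indicator_def mem_box_cart)
  finally show ?thesis .
qed

lemma test_function_continuous: "test_function D \<phi> \<Longrightarrow> continuous_on UNIV \<phi>"
  unfolding test_function_def by (metis C_k.simps(1))

lemma test_function_bounded:
  assumes "test_function D \<phi>"
  obtains B where "\<And>x. \<bar>\<phi> x\<bar> \<le> B"
proof -
  let ?K = "closure {x. \<phi> x \<noteq> 0}"
  have "compact (\<phi> ` ?K)"
    using assms test_function_continuous[OF assms] unfolding test_function_def
    by (intro compact_continuous_image) (auto intro: continuous_on_subset)
  then obtain B where B: "\<And>y. y \<in> \<phi> ` ?K \<Longrightarrow> \<bar>y\<bar> \<le> B"
    by (meson bounded_real compact_imp_bounded)
  have "\<bar>\<phi> x\<bar> \<le> max B 0" for x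
    using B[of "\<phi> x"] closure_subset[of "{x. \<phi> x \<noteq> 0}"] by (cases "\<phi> x = 0") force+
  then show thesis by (rule that)
qed

section \<open>Testing against smooth functions\<close>

lemma open_sets_lebesgue: "open D \<Longrightarrow> D \<in> sets lebesgue" for D :: "'a::euclidean_space set"
  by (metis borel_open sets_completionI_sets sets_lborel)

text \<open>
  The fundamental lemma of the calculus of variations. By dominated convergence the integral
  of \<open>h\<close> vanishes over every box whose closure lies in \<open>D\<close>; at
  almost every point, \<open>h\<close> is the limit of its averages over cubes that shrink to
  the point.
\<close>

lemma AE_0_if_orthogonal_to_test_functions:
  fixes h :: "real^'d \<Rightarrow> real"
  assumes D: "open D" and h: "integrable (lebesgue_on D) h"
    and orth: "\<And>\<phi>. test_function D \<phi> \<Longrightarrow> (LINT x|lebesgue_on D. h x * \<phi> x) = 0"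
  shows "AE x in lebesgue_on D. h x = 0"
proof -
  let ?f = "\<lambda>x. if x \<in> D then h x else 0"
  have D_sets: "D \<in> sets lebesgue"
    using D by (rule open_sets_lebesgue)
  have box: "(LINT x|lebesgue_on D. h x * indicator (box a b) x) = 0" if "cbox a b \<subseteq> D" for a b
  proof -
    have "(\<lambda>k. LINT x|lebesgue_on D. h x * box_bump (real (Suc k)) a b x) \<longlonglongrightarrow>
        (LINT x|lebesgue_on D. h x * indicator (box a b) x)"
    proof (rule integral_dominated_convergence[where w = "\<lambda>x. \<bar>h x\<bar>"])
      have "continuous_on UNIV (box_bump (real (Suc k)) a b)" for k
        using that by (intro test_function_continuous[OF box_bump_test_function]) auto
      then have "box_bump (real (Suc k)) a b \<in> borel_measurable (lebesgue_on D)" for k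
        using D_sets by (metis continuous_imp_measurable_on_sets_lebesgue continuous_on_subset subset_UNIV)
      then show "(\<lambda>x. h x * box_bump (real (Suc k)) a b x) \<in> borel_measurable (lebesgue_on D)" for k
        using h by measurable
      show "(\<lambda>x. h x * indicator (box a b) x) \<in> borel_measurable (lebesgue_on D)"
        using h box_subset_cbox[of a b] that
        by (intro borel_measurable_times borel_measurable_indicator) (auto simp: sets_restrict_space_iff D_sets)
      show "AE x in lebesgue_on D. norm (h x * box_bump (real (Suc k)) a b x) \<le> \<bar>h x\<bar>" for k
        by (auto simp: abs_mult box_bump_bounds intro!: mult_left_le)
    qed (use h in \<open>auto intro!: tendsto_intros box_bump_tendsto simp del: of_nat_Suc\<close>)
    moreover have "(LINT x|lebesgue_on D. h x * box_bump (real (Suc k)) a b x) = 0" for k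
      using that by (intro orth box_bump_test_function) auto
    ultimately show ?thesis
      by (simp add: LIMSEQ_const_iff del: of_nat_Suc)
  qed
  have f_int: "integrable lebesgue ?f"
    using h D_sets by (simp add: Lebesgue_Measure.integrable_restrict_UNIV)
  have f_abs: "?f absolutely_integrable_on S" if "S \<in> sets lebesgue" for S
    unfolding set_integrable_def using f_int that by (intro integrable_mult_indicator)
  have cube: "integral (cbox a b) ?f = 0" if "cbox a b \<subseteq> D" for a b
  proof -
    have "box a b \<subseteq> D"
      using that box_subset_cbox by blast
    have "integral (cbox a b) ?f = integral (box a b) ?f"
      by (simp add: integral_open_interval)
    also have "\<dots> = (LINT x:box a b|lebesgue. ?f x)"
      by (intro set_lebesgue_integral_eq_integral(2)[symmetric] f_abs) auto
    also have "\<dots> = (LINT x|lebesgue. (if x \<in> D then h x * indicator (box a b) x else 0))"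
      unfolding set_lebesgue_integral_def by (intro Bochner_Integration.integral_cong) (auto simp: indicator_def)
    also have "\<dots> = (LINT x|lebesgue_on D. h x * indicator (box a b) x)"
      using D_sets by (rule Lebesgue_Measure.integral_restrict_UNIV)
    finally show ?thesis
      using box[OF that] by simp
  qed
  have "?f integrable_on cbox a b" for a b
    by (intro set_lebesgue_integral_eq_integral(1) f_abs) auto
  from integrable_ccontinuous_explicit[of ?f, OF this] obtain Z where Z: "negligible Z"
    "\<And>x e. \<lbrakk>x \<notin> Z; 0 < e\<rbrakk> \<Longrightarrow> \<exists>d>0. \<forall>t. 0 < t \<and> t < d \<longrightarrow>
        norm (integral (cbox x (x + t *\<^sub>R One)) ?f /\<^sub>R t ^ DIM(real^'d) - ?f x) < e"
    by blast
  have "h x = 0" if x: "x \<in> D" "x \<notin> Z" for x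
  proof (rule ccontr)
    assume "h x \<noteq> 0"
    then obtain d where d: "d > 0" "\<And>t. 0 < t \<Longrightarrow> t < d \<Longrightarrow>
        norm (integral (cbox x (x + t *\<^sub>R One)) ?f /\<^sub>R t ^ DIM(real^'d) - ?f x) < \<bar>h x\<bar>"
      using Z(2)[OF x(2), of "\<bar>h x\<bar>"] by auto
    obtain \<epsilon> where \<epsilon>: "\<epsilon> > 0" "cball x \<epsilon> \<subseteq> D"
      using D x(1) open_contains_cball by blast
    \<comment> \<open>half of \<open>d\<close> because \<open>d\<close> itself is excluded; the other bound keeps the cube inside the ball, as the norm is at most the sum of the coordinates\<close>
  define t where "t = min (d / 2) (\<epsilon> / DIM(real^'d))"
    have t: "t > 0" "t < d" "DIM(real^'d) * t \<le> \<epsilon>"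
      using d(1) \<epsilon>(1) by (auto simp: t_def min_def field_simps)
    have "cbox x (x + t *\<^sub>R One) \<subseteq> cball x \<epsilon>"
    proof
      fix y assume "y \<in> cbox x (x + t *\<^sub>R One)"
      then have "\<bar>(y - x) \<bullet> i\<bar> \<le> t" if "i \<in> Basis" for i
        using that by (auto simp: mem_box inner_diff_left inner_add_left)
      then have "norm (y - x) \<le> (\<Sum>i\<in>(Basis :: (real^'d) set). t)"
        by (intro order_trans[OF norm_le_l1] sum_mono)
      then show "y \<in> cball x \<epsilon>"
        using t(3) by (simp add: dist_norm norm_minus_commute)
    qed
    then have "integral (cbox x (x + t *\<^sub>R One)) ?f = 0"
      using \<epsilon>(2) by (intro cube) blast
    then show False
      using d(2)[OF t(1,2)] x(1) by simp
  qed
  moreover have "AE x in lebesgue. x \<notin> Z"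
    using Z(1) by (simp add: negligible_iff_null_sets AE_not_in)
  ultimately show ?thesis
    using D_sets by (subst AE_restrict_space_iff) auto
qed

lemma integral_translate_lborel:
  fixes \<zeta> :: "'a::euclidean_space \<Rightarrow> real"
  assumes "integrable lborel \<zeta>"
  shows "integrable lborel (\<lambda>x. \<zeta> (c + x))" "(LINT x|lborel. \<zeta> (c + x)) = (LINT x|lborel. \<zeta> x)"
proof -
  have m: "\<zeta> \<in> borel_measurable borel"
    using assms by simp
  have "integrable (distr lborel borel ((+) c)) \<zeta>"
    using assms by (simp add: lborel_distr_plus)
  then show "integrable lborel (\<lambda>x. \<zeta> (c + x))"
    using m by (subst (asm) integrable_distr_eq) auto
  have "(LINT x|lborel. \<zeta> x) = (LINT x|distr lborel borel ((+) c). \<zeta> x)"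
    by (simp add: lborel_distr_plus)
  then show "(LINT x|lborel. \<zeta> (c + x)) = (LINT x|lborel. \<zeta> x)"
    using m by (subst (asm) integral_distr) auto
qed

lemma integrable_lborel_compact_support:
  fixes \<zeta> :: "'a::euclidean_space \<Rightarrow> real"
  assumes "continuous_on UNIV \<zeta>" "compact K" "\<And>x. x \<notin> K \<Longrightarrow> \<zeta> x = 0"
  shows "integrable lborel \<zeta>"
proof -
  have "integrable lborel (\<lambda>x. indicator K x *\<^sub>R \<zeta> x)"
    using assms by (intro borel_integrable_compact) (auto intro: continuous_on_subset)
  moreover have "(\<lambda>x. indicator K x *\<^sub>R \<zeta> x) = \<zeta>"
    using assms(3) by (auto simp: indicator_def fun_eq_iff)
  ultimately show ?thesis
    by simp
qed

text \<open>
  The integral of the difference quotient of \<open>\<zeta>\<close> in the direction of the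
  axis \<open>i\<close> vanishes by translation invariance. The quotients converge to the
  partial derivative; by the mean value theorem they share a bound on a common ball, outside
  of which they vanish.
\<close>

lemma integral_partial_deriv_eq_0:
  fixes \<zeta> :: "real^'d \<Rightarrow> real"
  assumes diff: "\<And>x. \<zeta> differentiable (at x)"
    and cont: "continuous_on UNIV (partial_deriv i \<zeta>)"
    and K: "compact K" "\<And>x. x \<notin> K \<Longrightarrow> \<zeta> x = 0"
  shows "(LINT x|lborel. partial_deriv i \<zeta> x) = 0"
proof -
  let ?p = "partial_deriv i \<zeta>" and ?e = "axis i (1::real) :: real^'d"
  obtain R where R: "K \<subseteq> cball 0 R"
    using compact_imp_bounded[OF K(1)] unfolding bounded_any_center[where a = 0] by (auto simp: subset_eq)
  have \<zeta>_0: "\<zeta> x = 0" if "norm x > R" for x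
    using that R K(2)[of x] by force
  have p_0: "?p x = 0" if "norm x > R" for x
  proof -
    have "(\<zeta> has_derivative (\<lambda>_. 0)) (at x)"
      by (rule has_derivative_transform_within_open[where f = "\<lambda>_. 0" and s = "- cball 0 R"])
        (use that \<zeta>_0 in \<open>auto intro: open_Compl\<close>)
    then show ?thesis
      by (simp add: partial_deriv_eq)
  qed
  have "compact (?p ` cball 0 R)"
    using cont by (intro compact_continuous_image) (auto intro: continuous_on_subset)
  then obtain B0 where B0: "\<And>x. x \<in> cball 0 R \<Longrightarrow> \<bar>?p x\<bar> \<le> B0"
    by (metis (no_types, lifting) bounded_real compact_imp_bounded image_eqI)
  define B where "B = max B0 0"
  have B: "\<bar>?p x\<bar> \<le> B" for x
    using B0[of x] p_0[of x] by (cases "norm x \<le> R") (auto simp: B_def)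
  have line: "((\<lambda>t. \<zeta> (t *\<^sub>R ?e + x)) has_real_derivative ?p (t *\<^sub>R ?e + x)) (at t)" for t x
  proof -
    have "((\<lambda>t. \<zeta> (t *\<^sub>R ?e + x)) has_derivative (\<lambda>s. frechet_derivative \<zeta> (at (t *\<^sub>R ?e + x)) (s *\<^sub>R ?e))) (at t)"
      by (rule has_derivative_compose[OF _ has_derivative_frechet[OF diff]])
        (auto intro!: derivative_eq_intros)
    moreover have "frechet_derivative \<zeta> (at y) (s *\<^sub>R ?e) = ?p y * s" for s y
      using linear_frechet_derivative[OF diff[of y]] by (simp add: linear_scale partial_deriv_def)
    ultimately show ?thesis
      by (simp add: has_field_derivative_def)
  qed
  define d where "d k x = (\<zeta> (inverse (real (Suc k)) *\<^sub>R ?e + x) - \<zeta> x) / inverse (real (Suc k))" for k x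
  have \<zeta>_int: "integrable lborel \<zeta>"
    using diff K by (intro integrable_lborel_compact_support)
      (auto intro!: continuous_at_imp_continuous_on differentiable_imp_continuous_within)
  have d_int: "integrable lborel (d k)" "(LINT x|lborel. d k x) = 0" for k
    unfolding d_def using integral_translate_lborel[OF \<zeta>_int] \<zeta>_int
    by (simp_all del: of_nat_Suc)
  have "(\<lambda>k. LINT x|lborel. d k x) \<longlonglongrightarrow> (LINT x|lborel. ?p x)"
  proof (rule integral_dominated_convergence[where w = "\<lambda>x. indicator (cball 0 (R + 1)) x *\<^sub>R B"])
    show "?p \<in> borel_measurable lborel"
      using cont by (simp add: borel_measurable_continuous_onI)
    show "integrable lborel (\<lambda>x. indicator (cball 0 (R + 1)) x *\<^sub>R B)"
      by (intro borel_integrable_compact) auto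
    show "AE x in lborel. (\<lambda>k. d k x) \<longlonglongrightarrow> ?p x"
    proof (rule AE_I2)
      fix x
      have "((\<lambda>t. (\<zeta> (t *\<^sub>R ?e + x) - \<zeta> x) / t) \<longlongrightarrow> ?p x) (at 0)"
        using line[of x 0] by (simp add: DERIV_def)
      moreover have "filterlim (\<lambda>k. inverse (real (Suc k))) (at 0) sequentially"
        using LIMSEQ_inverse_real_of_nat by (simp add: filterlim_at)
      ultimately show "(\<lambda>k. d k x) \<longlonglongrightarrow> ?p x"
        unfolding d_def by (rule filterlim_compose)
    qed
    show "AE x in lborel. norm (d k x) \<le> indicator (cball 0 (R + 1)) x *\<^sub>R B" for k
    proof (rule AE_I2)
      fix x
      let ?h = "inverse (real (Suc k))"
      have h: "0 < ?h" "?h \<le> 1"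
        by (auto simp: field_simps)
      show "norm (d k x) \<le> indicator (cball 0 (R + 1)) x *\<^sub>R B"
      proof (cases "norm x \<le> R + 1")
        case True
        obtain z where "\<zeta> (?h *\<^sub>R ?e + x) - \<zeta> (0 *\<^sub>R ?e + x) = (?h - 0) * ?p (z *\<^sub>R ?e + x)"
          using MVT2[OF h(1), of "\<lambda>t. \<zeta> (t *\<^sub>R ?e + x)" "\<lambda>t. ?p (t *\<^sub>R ?e + x)"] line by auto
        then have "d k x = ?p (z *\<^sub>R ?e + x)"
          using h by (simp add: d_def del: of_nat_Suc)
        then show ?thesis
          using True B by simp
      next
        case False
        have "norm x \<le> norm (?h *\<^sub>R ?e + x) + norm (?h *\<^sub>R ?e)"
          by (metis add_diff_cancel_left' norm_triangle_ineq4 add.commute)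
        moreover have "norm (?h *\<^sub>R ?e) \<le> 1"
          using h by simp
        ultimately show ?thesis
          using False by (simp add: d_def \<zeta>_0)
      qed
    qed
  qed (use d_int in auto)
  then show ?thesis
    by (simp add: d_int LIMSEQ_const_iff)
qed

section \<open>Weak gradients\<close>

lemma finite_measure_on_domain: "open D \<Longrightarrow> bounded D \<Longrightarrow> finite_measure (lebesgue_on D)"
  for D :: "'a::euclidean_space set"
  by (intro finite_measure_lebesgue_on lmeasurable_open)

lemma L2_integrable:
  fixes g :: "real^'d \<Rightarrow> real"
  assumes "open D" "bounded D" "g \<in> L2 D"
  shows "integrable (lebesgue_on D) g"
proof -
  have "integrable (lebesgue_on D) (\<lambda>x. g x * 1)"
    using assms finite_measure.integrable_const[OF finite_measure_on_domain[OF assms(1,2)], of 1]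
    by (intro integrable_product_of_squares) (auto simp: L2_def)
  then show ?thesis
    by simp
qed

lemma bounded_continuous_L2:
  fixes \<phi> :: "real^'d \<Rightarrow> real"
  assumes D: "open D" "bounded D" and \<phi>: "continuous_on UNIV \<phi>" "\<And>x. \<bar>\<phi> x\<bar> \<le> B"
  shows "\<phi> \<in> L2 D"
proof -
  have m: "\<phi> \<in> borel_measurable (lebesgue_on D)"
    using \<phi>(1) open_sets_lebesgue[OF D(1)]
    by (metis continuous_imp_measurable_on_sets_lebesgue continuous_on_subset subset_UNIV)
  have "(\<bar>\<phi> x\<bar>)\<^sup>2 \<le> B\<^sup>2" for x
    using \<phi>(2) by (intro power_mono) auto
  then have "integrable (lebesgue_on D) (\<lambda>x. (\<phi> x)\<^sup>2)"
    using m by (intro finite_measure.integrable_const_bound[OF finite_measure_on_domain[OF D], of _ "B\<^sup>2"]) auto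
  then show ?thesis
    using m by (simp add: L2_def)
qed

lemma test_function_L2: "open D \<Longrightarrow> bounded D \<Longrightarrow> test_function D \<phi> \<Longrightarrow> \<phi> \<in> L2 D"
  by (metis bounded_continuous_L2 test_function_bounded test_function_continuous)

lemma test_function_differentiable: "test_function D \<phi> \<Longrightarrow> \<phi> differentiable (at x)"
proof -
  assume "test_function D \<phi>"
  then have "C_k (Suc 0) \<phi>"
    unfolding test_function_def by blast
  then show ?thesis
    by (simp add: differentiable_on_def)
qed

lemma partial_deriv_outside_closed_support:
  assumes "x \<notin> closure {x. \<phi> x \<noteq> 0}"
  shows "partial_deriv i \<phi> x = 0"
proof -
  have "(\<phi> has_derivative (\<lambda>_. 0)) (at x)"
    by (rule has_derivative_transform_within_open[where f = "\<lambda>_. 0" and s = "- closure {x. \<phi> x \<noteq> 0}"])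
      (use assms closure_subset[of "{x. \<phi> x \<noteq> 0}"] in \<open>auto\<close>)
  then show ?thesis
    by (simp add: partial_deriv_eq)
qed

lemma test_function_closed_support:
  assumes "test_function D \<phi>"
  shows "compact (closure {x. \<phi> x \<noteq> 0})" "x \<notin> closure {x. \<phi> x \<noteq> 0} \<Longrightarrow> \<phi> x = 0"
  using assms closure_subset[of "{x. \<phi> x \<noteq> 0}"] unfolding test_function_def by blast+

lemma test_function_partial_deriv:
  assumes "test_function D \<phi>"
  shows "test_function D (partial_deriv i \<phi>)"
proof -
  have "C_k (Suc k) \<phi>" for k
    using assms unfolding test_function_def by blast
  then have "C_k k (partial_deriv i \<phi>)" for k
    by simp
  moreover have sub: "closure {x. partial_deriv i \<phi> x \<noteq> 0} \<subseteq> closure {x. \<phi> x \<noteq> 0}"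
    using partial_deriv_outside_closed_support[of _ \<phi> i] by (intro closure_minimal) auto
  moreover have "compact (closure {x. partial_deriv i \<phi> x \<noteq> 0})"
    using assms sub compact_Int_closed[of "closure {x. \<phi> x \<noteq> 0}" "closure {x. partial_deriv i \<phi> x \<noteq> 0}"]
    by (simp add: test_function_def Int_absorb1)
  ultimately show ?thesis
    using assms by (auto simp: test_function_def)
qed

lemma test_function_outside: "test_function D \<phi> \<Longrightarrow> x \<notin> D \<Longrightarrow> \<phi> x = 0"
  using closure_subset[of "{x. \<phi> x \<noteq> 0}"] by (auto simp: test_function_def)

lemma integral_lebesgue_on_eq_lborel:
  fixes g :: "'a::euclidean_space \<Rightarrow> real"
  assumes "open D" "g \<in> borel_measurable borel" "\<And>x. x \<notin> D \<Longrightarrow> g x = 0"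
  shows "(LINT x|lebesgue_on D. g x) = (LINT x|lborel. g x)"
proof -
  have "(LINT x|lebesgue_on D. g x) = (LINT x|lebesgue. (if x \<in> D then g x else 0))"
    by (simp only: Lebesgue_Measure.integral_restrict_UNIV[OF open_sets_lebesgue[OF assms(1)]])
  also have "(\<lambda>x. if x \<in> D then g x else 0) = g"
    using assms(3) by auto
  finally show ?thesis
    using assms(2) by (simp add: integral_completion)
qed

lemma has_weak_gradientD:
  "has_weak_gradient D v g \<Longrightarrow> test_function D \<phi> \<Longrightarrow>
    (LINT x|lebesgue_on D. v x * partial_deriv i \<phi> x) = - (LINT x|lebesgue_on D. g x $ i * \<phi> x)"
  by (simp add: has_weak_gradient_def)

text \<open>
  The components of the difference of two weak gradients are orthogonal to all test functions.
  Boundedness of \<open>D\<close> makes them integrable.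
\<close>

lemma weak_gradient_unique:
  fixes D :: "(real^'d) set"
  assumes D: "open D" "bounded D"
    and g: "g \<in> L2 D" "has_weak_gradient D v g" and g': "g' \<in> L2 D" "has_weak_gradient D v g'"
  shows "AE x in lebesgue_on D. g x = g' x"
proof -
  have "AE x in lebesgue_on D. g x $ i - g' x $ i = 0" for i
  proof (rule AE_0_if_orthogonal_to_test_functions[OF D(1)])
    show "integrable (lebesgue_on D) (\<lambda>x. g x $ i - g' x $ i)"
      using g(1) g'(1) by (intro L2_integrable[OF D] L2_diff L2_component)
    fix \<phi> assume \<phi>: "test_function D \<phi>"
    have "integrable (lebesgue_on D) (\<lambda>x. g x $ i * \<phi> x)" "integrable (lebesgue_on D) (\<lambda>x. g' x $ i * \<phi> x)"
      using integrable_L2_inner[OF L2_component[OF g(1)] test_function_L2[OF D \<phi>]]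
        integrable_L2_inner[OF L2_component[OF g'(1)] test_function_L2[OF D \<phi>]] by simp_all
    then show "(LINT x|lebesgue_on D. (g x $ i - g' x $ i) * \<phi> x) = 0"
      using has_weak_gradientD[OF g(2) \<phi>, of i] has_weak_gradientD[OF g'(2) \<phi>, of i]
      by (simp add: left_diff_distrib)
  qed
  then have "AE x in lebesgue_on D. \<forall>i. g x $ i - g' x $ i = 0"
    by (simp add: AE_all_countable)
  then show ?thesis
    by eventually_elim (simp add: vec_eq_iff)
qed

lemma weak_grad_H1:
  assumes "v \<in> H1 D"
  shows "weak_grad D v \<in> L2 D" "has_weak_gradient D v (weak_grad D v)"
proof -
  have "\<exists>g. g \<in> L2 D \<and> has_weak_gradient D v g"
    using assms by (auto simp: H1_def)
  from someI_ex[OF this] show "weak_grad D v \<in> L2 D" "has_weak_gradient D v (weak_grad D v)"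
    by (auto simp: weak_grad_def)
qed

lemma H1_L2: "v \<in> H1 D \<Longrightarrow> v \<in> L2 D"
  by (simp add: H1_def)

lemma has_weak_gradient_sum:
  fixes D :: "(real^'d) set"
  assumes D: "open D" "bounded D" and v: "\<And>k. k \<in> I \<Longrightarrow> v k \<in> H1 D"
  shows "has_weak_gradient D (\<lambda>x. \<Sum>k\<in>I. c k * v k x) (\<lambda>x. \<Sum>k\<in>I. c k *\<^sub>R weak_grad D (v k) x)"
  unfolding has_weak_gradient_def
proof (intro allI impI)
  fix \<phi> i assume \<phi>: "test_function D \<phi>"
  have int: "integrable (lebesgue_on D) (\<lambda>x. v k x * partial_deriv i \<phi> x)"
    "integrable (lebesgue_on D) (\<lambda>x. weak_grad D (v k) x $ i * \<phi> x)" if "k \<in> I" for k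
    using integrable_L2_inner[OF H1_L2[OF v[OF that]] test_function_L2[OF D test_function_partial_deriv[OF \<phi>]]]
      integrable_L2_inner[OF L2_component[OF weak_grad_H1(1)[OF v[OF that]]] test_function_L2[OF D \<phi>]]
    by simp_all
  have "(LINT x|lebesgue_on D. (\<Sum>k\<in>I. c k * v k x) * partial_deriv i \<phi> x) =
      (\<Sum>k\<in>I. c k * (LINT x|lebesgue_on D. v k x * partial_deriv i \<phi> x))"
    using int by (simp add: sum_distrib_right mult.assoc)
  also have "\<dots> = - (\<Sum>k\<in>I. c k * (LINT x|lebesgue_on D. weak_grad D (v k) x $ i * \<phi> x))"
    using has_weak_gradientD[OF weak_grad_H1(2)[OF v] \<phi>] by (simp add: sum_negf)
  also have "(\<Sum>k\<in>I. c k * (LINT x|lebesgue_on D. weak_grad D (v k) x $ i * \<phi> x)) =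
      (LINT x|lebesgue_on D. (\<Sum>k\<in>I. c k *\<^sub>R weak_grad D (v k) x) $ i * \<phi> x)"
    using int by (simp add: sum_component sum_distrib_right mult.assoc)
  finally show "(LINT x|lebesgue_on D. (\<Sum>k\<in>I. c k * v k x) * partial_deriv i \<phi> x) =
      - (LINT x|lebesgue_on D. (\<Sum>k\<in>I. c k *\<^sub>R weak_grad D (v k) x) $ i * \<phi> x)" .
qed

lemma H1_sum:
  fixes D :: "(real^'d) set"
  assumes D: "open D" "bounded D" and v: "\<And>k. k \<in> I \<Longrightarrow> v k \<in> H1 D"
  shows "(\<lambda>x. \<Sum>k\<in>I. c k * v k x) \<in> H1 D"
  unfolding H1_def
proof (intro CollectI conjI bexI)
  show "(\<lambda>x. \<Sum>k\<in>I. c k * v k x) \<in> L2 D"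
    using L2_sum[of I v D c] H1_L2[OF v] by simp
  show "(\<lambda>x. \<Sum>k\<in>I. c k *\<^sub>R weak_grad D (v k) x) \<in> L2 D"
    using weak_grad_H1(1)[OF v] by (intro L2_sum)
qed (rule has_weak_gradient_sum[OF D v])

text \<open>
  Linearity of the weak gradient, for sums that need to agree with \<open>w\<close> only
  almost everywhere: weak gradients do not see null sets.
\<close>

lemma weak_grad_sum_AE:
  fixes D :: "(real^'d) set"
  assumes D: "open D" "bounded D" and v: "\<And>k. k \<in> I \<Longrightarrow> v k \<in> H1 D"
    and w: "w \<in> H1 D" "AE x in lebesgue_on D. w x = (\<Sum>k\<in>I. c k * v k x)"
  shows "AE x in lebesgue_on D. weak_grad D w x = (\<Sum>k\<in>I. c k *\<^sub>R weak_grad D (v k) x)"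
proof (rule weak_gradient_unique[OF D weak_grad_H1[OF w(1)]])
  show "(\<lambda>x. \<Sum>k\<in>I. c k *\<^sub>R weak_grad D (v k) x) \<in> L2 D"
    using weak_grad_H1(1)[OF v] by (intro L2_sum)
  show "has_weak_gradient D w (\<lambda>x. \<Sum>k\<in>I. c k *\<^sub>R weak_grad D (v k) x)"
    unfolding has_weak_gradient_def
  proof (intro allI impI)
    fix \<phi> i assume \<phi>: "test_function D \<phi>"
    let ?s = "\<lambda>x. \<Sum>k\<in>I. c k * v k x"
    have "L2_inner D w (partial_deriv i \<phi>) = L2_inner D ?s (partial_deriv i \<phi>)"
      by (intro L2_inner_cong_AE w(2) H1_L2 w(1) H1_sum[OF D v] test_function_L2[OF D test_function_partial_deriv[OF \<phi>]])
    moreover have "has_weak_gradient D ?s (\<lambda>x. \<Sum>k\<in>I. c k *\<^sub>R weak_grad D (v k) x)"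
      by (rule has_weak_gradient_sum[OF D v])
    note has_weak_gradientD[OF this \<phi>, of i]
    ultimately show "(LINT x|lebesgue_on D. w x * partial_deriv i \<phi> x) =
        - (LINT x|lebesgue_on D. (\<Sum>k\<in>I. c k *\<^sub>R weak_grad D (v k) x) $ i * \<phi> x)"
      by (simp add: L2_inner_def)
  qed
qed

text \<open>
  Integration by parts: the product of two test functions has compact support, so the integral
  of each of its partial derivatives is \<open>0\<close>.
\<close>

lemma test_function_has_weak_gradient:
  fixes D :: "(real^'d) set"
  assumes D: "open D" and \<phi>: "test_function D \<phi>"
  shows "has_weak_gradient D \<phi> (\<lambda>x. \<chi> i. partial_deriv i \<phi> x)"
  unfolding has_weak_gradient_def
proof (intro allI impI)
  fix \<psi> i assume \<psi>: "test_function D \<psi>"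
  note d = test_function_differentiable[OF \<phi>] test_function_differentiable[OF \<psi>]
  note c = test_function_continuous[OF \<phi>] test_function_continuous[OF \<psi>]
    test_function_continuous[OF test_function_partial_deriv[OF \<phi>]]
    test_function_continuous[OF test_function_partial_deriv[OF \<psi>]]
  note z = test_function_outside[OF \<phi>] test_function_outside[OF \<psi>]
  let ?K = "closure {x. \<phi> x \<noteq> 0}"
  note K = test_function_closed_support[OF \<phi>]
  have pd: "partial_deriv i (\<lambda>x. \<phi> x * \<psi> x) =
      (\<lambda>x. \<phi> x * partial_deriv i \<psi> x + partial_deriv i \<phi> x * \<psi> x)"
    by (rule ext) (rule partial_deriv_mult[OF d])
  have c': "continuous_on UNIV (\<lambda>x. \<phi> x * partial_deriv i \<psi> x)"
    "continuous_on UNIV (\<lambda>x. partial_deriv i \<phi> x * \<psi> x)"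
    by (intro continuous_on_mult c)+
  have int: "integrable lborel (\<lambda>x. \<phi> x * partial_deriv i \<psi> x)"
    by (rule integrable_lborel_compact_support[OF c'(1) K(1)]) (metis K(2) mult_zero_left)
  have int': "integrable lborel (\<lambda>x. partial_deriv i \<phi> x * \<psi> x)"
    by (rule integrable_lborel_compact_support[OF c'(2) K(1)])
      (metis partial_deriv_outside_closed_support mult_zero_left)
  have "(LINT x|lborel. partial_deriv i (\<lambda>x. \<phi> x * \<psi> x) x) = 0"
  proof (rule integral_partial_deriv_eq_0[OF _ _ K(1)])
    show "(\<lambda>x. \<phi> x * \<psi> x) differentiable (at x)" for x
      by (intro differentiable_mult d)
    show "continuous_on UNIV (partial_deriv i (\<lambda>x. \<phi> x * \<psi> x))"
      unfolding pd by (intro continuous_on_add c')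
    show "\<phi> x * \<psi> x = 0" if "x \<notin> ?K" for x
      using K(2)[OF that] by simp
  qed
  then have "(LINT x|lborel. \<phi> x * partial_deriv i \<psi> x) = - (LINT x|lborel. partial_deriv i \<phi> x * \<psi> x)"
    unfolding pd Bochner_Integration.integral_add[OF int int'] by simp
  moreover have "(LINT x|lebesgue_on D. \<phi> x * partial_deriv i \<psi> x) = (LINT x|lborel. \<phi> x * partial_deriv i \<psi> x)"
    by (rule integral_lebesgue_on_eq_lborel[OF D borel_measurable_continuous_onI[OF c'(1)]]) (simp add: z)
  moreover have "(LINT x|lebesgue_on D. partial_deriv i \<phi> x * \<psi> x) = (LINT x|lborel. partial_deriv i \<phi> x * \<psi> x)"
    by (rule integral_lebesgue_on_eq_lborel[OF D borel_measurable_continuous_onI[OF c'(2)]]) (simp add: z)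
  ultimately show "(LINT x|lebesgue_on D. \<phi> x * partial_deriv i \<psi> x) =
      - (LINT x|lebesgue_on D. (\<chi> i. partial_deriv i \<phi> x) $ i * \<psi> x)"
    unfolding vec_lambda_beta by (simp only:)
qed

lemma L2_times_vector: "g \<in> L2 D \<Longrightarrow> (\<lambda>x. g x *\<^sub>R c) \<in> L2 D" for g :: "real^'d \<Rightarrow> real"
  by (auto simp: L2_def power_mult_distrib)

lemma test_function_H1:
  fixes D :: "(real^'d) set"
  assumes D: "open D" "bounded D" and \<phi>: "test_function D \<phi>"
  shows "\<phi> \<in> H1 D" "AE x in lebesgue_on D. weak_grad D \<phi> x = (\<chi> i. partial_deriv i \<phi> x)"
proof -
  let ?g = "\<lambda>x. \<chi> i. partial_deriv i \<phi> x"
  have "partial_deriv i \<phi> \<in> L2 D" for i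
    by (intro test_function_L2[OF D] test_function_partial_deriv \<phi>)
  then have "(\<lambda>x. partial_deriv i \<phi> x *\<^sub>R axis i (1::real)) \<in> L2 D" for i
    by (rule L2_times_vector)
  then have "(\<lambda>x. \<Sum>i\<in>UNIV. 1 *\<^sub>R (partial_deriv i \<phi> x *\<^sub>R axis i (1::real))) \<in> L2 D"
    by (intro L2_sum)
  moreover have "(\<Sum>i\<in>UNIV. 1 *\<^sub>R (partial_deriv i \<phi> x *\<^sub>R axis i (1::real))) = ?g x" for x
    using basis_expansion[of "?g x"] unfolding scalar_mult_eq_scaleR scaleR_one vec_lambda_beta .
  ultimately have g: "?g \<in> L2 D"
    by (simp only:)
  have wg: "has_weak_gradient D \<phi> ?g"
    using D(1) \<phi> by (rule test_function_has_weak_gradient)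
  show H1: "\<phi> \<in> H1 D"
    unfolding H1_def
  proof (intro CollectI conjI)
    show "\<phi> \<in> L2 D"
      by (rule test_function_L2[OF D \<phi>])
    show "\<exists>g\<in>L2 D. has_weak_gradient D \<phi> g"
      using g wg by blast
  qed
  show "AE x in lebesgue_on D. weak_grad D \<phi> x = ?g x"
    by (rule weak_gradient_unique[OF D weak_grad_H1[OF H1] g wg])
qed

section \<open>Poincare inequality and duality\<close>

text \<open>
  Integrate \<open>\<partial>\<^sub>i (x\<^sub>i \<phi>\<^sup>2) = \<phi>\<^sup>2 + 2
  x\<^sub>i \<phi> \<partial>\<^sub>i\<phi>\<close>, whose integral is \<open>0\<close>, and
  absorb half of \<open>\<phi>\<^sup>2\<close> by Young's inequality.
\<close>

lemma Poincare_test_function: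
  fixes D :: "(real^'d) set"
  assumes D: "open D" "bounded D" "\<And>x. x \<in> D \<Longrightarrow> \<bar>x $ i\<bar> \<le> R" and \<phi>: "test_function D \<phi>"
  shows "L2_inner D \<phi> \<phi> \<le> 4 * R\<^sup>2 * L2_inner D (partial_deriv i \<phi>) (partial_deriv i \<phi>)"
proof -
  let ?p = "partial_deriv i \<phi>" and ?\<zeta> = "\<lambda>x. x $ i * (\<phi> x * \<phi> x)"
  note d = test_function_differentiable[OF \<phi>]
  note c = test_function_continuous[OF \<phi>] test_function_continuous[OF test_function_partial_deriv[OF \<phi>]]
  let ?K = "closure {x. \<phi> x \<noteq> 0}"
  note K = test_function_closed_support[OF \<phi>]
  have coord': "((\<lambda>x. x $ i) has_derivative (\<lambda>h. h $ i)) (at x)" for x :: "real^'d"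
    by (rule bounded_linear.has_derivative[OF bounded_linear_vec_nth has_derivative_ident])
  then have coord: "(\<lambda>x::real^'d. x $ i) differentiable (at x)" for x
    by (auto simp: differentiable_def)
  have pd: "partial_deriv i ?\<zeta> = (\<lambda>x. \<phi> x * \<phi> x + 2 * (x $ i) * \<phi> x * ?p x)"
  proof
    fix x
    have "partial_deriv i (\<lambda>x. x $ i) x = 1"
      using partial_deriv_eq[OF coord'] by simp
    then show "partial_deriv i ?\<zeta> x = \<phi> x * \<phi> x + 2 * (x $ i) * \<phi> x * ?p x"
      using d coord by (simp add: partial_deriv_mult algebra_simps)
  qed
  have cpd: "continuous_on UNIV (partial_deriv i ?\<zeta>)"
    unfolding pd using c by (intro continuous_intros) auto
  have "(LINT x|lborel. partial_deriv i ?\<zeta> x) = 0"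
  proof (rule integral_partial_deriv_eq_0[OF _ cpd K(1)])
    show "?\<zeta> differentiable (at x)" for x
      by (intro differentiable_mult coord d)
    show "?\<zeta> x = 0" if "x \<notin> ?K" for x
      using K(2)[OF that] by simp
  qed
  then have zero: "(LINT x|lebesgue_on D. partial_deriv i ?\<zeta> x) = 0"
    using test_function_outside[OF \<phi>] borel_measurable_continuous_onI[OF cpd]
    by (subst integral_lebesgue_on_eq_lborel[OF D(1)]) (auto simp: pd)
  have L2: "\<phi> \<in> L2 D" "?p \<in> L2 D"
    using test_function_L2[OF D(1,2)] \<phi> test_function_partial_deriv by blast+
  have int: "integrable (lebesgue_on D) (\<lambda>x. \<phi> x * \<phi> x)" "integrable (lebesgue_on D) (\<lambda>x. ?p x * ?p x)"
    using integrable_L2_inner[OF L2(1) L2(1)] integrable_L2_inner[OF L2(2) L2(2)] by simp_all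
  have "integrable lborel (partial_deriv i ?\<zeta>)"
  proof (rule integrable_lborel_compact_support[OF cpd K(1)])
    show "partial_deriv i ?\<zeta> x = 0" if "x \<notin> ?K" for x
      using K(2)[OF that] by (simp add: pd)
  qed
  then have "integrable lebesgue (partial_deriv i ?\<zeta>)"
    using borel_measurable_continuous_onI[OF cpd] by (subst integrable_completion) auto
  then have pd_int: "integrable (lebesgue_on D) (partial_deriv i ?\<zeta>)"
    by (subst integrable_restrict_space)
      (auto simp only: space_completion space_lborel Int_UNIV_right space_borel
        intro: open_sets_lebesgue[OF D(1)] integrable_mult_indicator[OF open_sets_lebesgue[OF D(1)]])
  have "L2_inner D \<phi> \<phi> \<le> (LINT x|lebesgue_on D. partial_deriv i ?\<zeta> x + ((1/2) * (\<phi> x * \<phi> x) + 2 * R\<^sup>2 * (?p x * ?p x)))"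
    unfolding L2_inner_def
  proof (rule integral_mono)
    show "\<phi> x \<bullet> \<phi> x \<le> partial_deriv i ?\<zeta> x + ((1/2) * (\<phi> x * \<phi> x) + 2 * R\<^sup>2 * (?p x * ?p x))"
      if "x \<in> space (lebesgue_on D)" for x
    proof -
      have "2 * \<bar>x $ i\<bar> * \<bar>\<phi> x\<bar> * \<bar>?p x\<bar> \<le> \<bar>\<phi> x\<bar> * (2 * R * \<bar>?p x\<bar>)"
        using mult_right_mono[OF D(3)[of x], of "2 * \<bar>\<phi> x\<bar> * \<bar>?p x\<bar>"] that by (simp add: mult_ac)
      also have "\<dots> \<le> (1/2) * (\<phi> x * \<phi> x) + 2 * R\<^sup>2 * (?p x * ?p x)"
        using sum_squares_bound[of "\<bar>\<phi> x\<bar>" "2 * R * \<bar>?p x\<bar>"]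
        by (simp add: power_mult_distrib) (simp add: power2_eq_square mult_ac)
      also have "2 * \<bar>x $ i\<bar> * \<bar>\<phi> x\<bar> * \<bar>?p x\<bar> = \<bar>2 * (x $ i) * \<phi> x * ?p x\<bar>"
        by (simp only: abs_mult abs_numeral)
      finally have "\<bar>2 * (x $ i) * \<phi> x * ?p x\<bar> \<le> (1/2) * (\<phi> x * \<phi> x) + 2 * R\<^sup>2 * (?p x * ?p x)"
        .
      from order_trans[OF abs_ge_minus_self this] show ?thesis
        unfolding pd by simp
    qed
  qed (use int pd_int in auto)
  also have "\<dots> = (1/2) * L2_inner D \<phi> \<phi> + 2 * R\<^sup>2 * L2_inner D ?p ?p"
    using int pd_int by (simp add: zero L2_inner_def)
  finally show ?thesis
    by simp
qed

lemma H1_0_H1: "v \<in> H1_0 D \<Longrightarrow> v \<in> H1 D"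
  by (simp add: H1_0_def)

text \<open>
  The test functions that approximate \<open>v\<close> have gradients tending to
  \<open>0\<close> in \<open>L\<^sup>2\<close>; by the Poincare inequality they tend to
  \<open>0\<close> themselves.
\<close>

lemma H1_0_zero_gradient:
  fixes D :: "(real^'d) set"
  assumes D: "open D" "bounded D" and v: "v \<in> H1_0 D" and zero: "L2_norm D (weak_grad D v) = 0"
  shows "AE x in lebesgue_on D. v x = 0"
proof -
  note vL2 = H1_L2[OF H1_0_H1[OF v]] weak_grad_H1(1)[OF H1_0_H1[OF v]]
  obtain \<phi> where \<phi>: "\<And>k. test_function D (\<phi> k)"
    and lim: "(\<lambda>k. L2_norm D (\<lambda>x. v x - \<phi> k x)) \<longlonglongrightarrow> 0"
      "(\<lambda>k. L2_norm D (\<lambda>x. weak_grad D v x - weak_grad D (\<phi> k) x)) \<longlonglongrightarrow> 0"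
    using v unfolding H1_0_def by blast
  obtain R where "\<And>x. x \<in> D \<Longrightarrow> norm x \<le> R"
    using D(2) by (auto simp: bounded_iff)
  then have R: "\<bar>x $ i\<bar> \<le> R" if "x \<in> D" for x i
    by (rule order_trans[OF component_le_norm_cart]) (rule that)
  \<comment> \<open>any coordinate direction serves for the Poincare inequality\<close>
  define i :: 'd where "i = undefined"
  define dv where "dv k = L2_inner D (\<lambda>x. v x - \<phi> k x) (\<lambda>x. v x - \<phi> k x)" for k
  define dg where "dg k = L2_inner D (\<lambda>x. weak_grad D v x - weak_grad D (\<phi> k) x)
      (\<lambda>x. weak_grad D v x - weak_grad D (\<phi> k) x)" for k
  have "dv \<longlonglongrightarrow> 0" "dg \<longlonglongrightarrow> 0"
    using tendsto_power[OF lim(1), of 2] tendsto_power[OF lim(2), of 2]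
    by (simp_all add: L2_norm_square dv_def[abs_def] dg_def[abs_def])
  then have lim_0: "(\<lambda>k. 2 * dv k + 2 * (4 * R\<^sup>2 * dg k)) \<longlonglongrightarrow> 2 * 0 + 2 * (4 * R\<^sup>2 * 0)"
    by (intro tendsto_intros)
  have bound: "L2_inner D v v \<le> 2 * dv k + 2 * (4 * R\<^sup>2 * dg k)" for k
  proof -
    let ?p = "partial_deriv i (\<phi> k)"
    note L2 = test_function_L2[OF D \<phi>[of k]] test_function_L2[OF D test_function_partial_deriv[OF \<phi>[of k]], of i]
      weak_grad_H1(1)[OF test_function_H1(1)[OF D \<phi>[of k]]]
    have v_0: "AE x in lebesgue_on D. weak_grad D v x = 0"
      using zero L2_inner_self_eq_0_iff[OF vL2(2)] by (simp add: L2_norm_def)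
    have "L2_inner D ?p ?p \<le> dg k"
      unfolding dg_def L2_inner_def
    proof (rule integral_mono_AE)
      show "AE x in lebesgue_on D. ?p x \<bullet> ?p x \<le>
          (weak_grad D v x - weak_grad D (\<phi> k) x) \<bullet> (weak_grad D v x - weak_grad D (\<phi> k) x)"
        using v_0 test_function_H1(2)[OF D \<phi>[of k]]
      proof eventually_elim
        case (elim x)
        have "?p x = weak_grad D (\<phi> k) x $ i"
          using elim by simp
        then have "\<bar>?p x\<bar>\<^sup>2 \<le> (norm (weak_grad D (\<phi> k) x))\<^sup>2"
          by (metis component_le_norm_cart power_mono abs_ge_zero)
        then show ?case
          using elim by (simp add: power2_eq_square flip: power2_norm_eq_inner)
      qed
    qed (intro integrable_L2_inner L2_diff L2 vL2)+
    then have "4 * R\<^sup>2 * L2_inner D ?p ?p \<le> 4 * R\<^sup>2 * dg k"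
      by (intro mult_left_mono) auto
    then have "L2_inner D (\<phi> k) (\<phi> k) \<le> 4 * R\<^sup>2 * dg k"
      using Poincare_test_function[where i = i and \<phi> = "\<phi> k", OF D R \<phi>] by linarith
    moreover have "L2_inner D v v \<le> 2 * dv k + 2 * L2_inner D (\<phi> k) (\<phi> k)"
    proof -
      note int = integrable_L2_inner[OF vL2(1) vL2(1)] integrable_L2_inner[OF L2(1) L2(1)]
        integrable_L2_inner[OF L2_diff[OF vL2(1) L2(1)] L2_diff[OF vL2(1) L2(1)]]
      have "L2_inner D v v \<le> (LINT x|lebesgue_on D. 2 * ((v x - \<phi> k x) \<bullet> (v x - \<phi> k x)) + 2 * (\<phi> k x \<bullet> \<phi> k x))"
        unfolding L2_inner_def
      proof (rule integral_mono)
        show "v x \<bullet> v x \<le> 2 * ((v x - \<phi> k x) \<bullet> (v x - \<phi> k x)) + 2 * (\<phi> k x \<bullet> \<phi> k x)" for x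
          using zero_le_power2[of "v x - 2 * \<phi> k x"] by (simp add: power2_eq_square algebra_simps)
      qed (use int in simp_all)
      also have "\<dots> = 2 * dv k + 2 * L2_inner D (\<phi> k) (\<phi> k)"
        using int by (simp add: dv_def L2_inner_def)
      finally show ?thesis .
    qed
    ultimately show ?thesis
      by linarith
  qed
  have "L2_inner D v v \<le> 0"
  proof -
    have "\<exists>N. \<forall>k\<ge>N. L2_inner D v v \<le> 2 * dv k + 2 * (4 * R\<^sup>2 * dg k)"
      by (intro exI allI impI bound)
    from LIMSEQ_le_const[OF lim_0 this] show ?thesis
      unfolding mult_zero_right add_0 .
  qed
  then have "L2_inner D v v = 0"
    using L2_inner_self_nonneg by (rule antisym)
  then show ?thesis
    by (rule L2_inner_self_eq_0_iff[OF vL2(1), THEN iffD1])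
qed

text \<open>
  If \<open>v\<close> vanishes almost everywhere, it does not contribute to the supremum and
  the claim is trivial. Otherwise its gradient has a positive norm, so the quotient in the
  supremum is genuine.
\<close>

lemma L2_inner_le_Hm1_norm:
  fixes D :: "(real^'d) set"
  assumes D: "open D" "bounded D" and v: "v \<in> H1_0 D" and F: "Hm1_norm D F \<le> ennreal r" "0 \<le> r"
  shows "L2_inner D F v \<le> r * L2_norm D (weak_grad D v)"
proof (cases "AE x in lebesgue_on D. v x = 0")
  case True
  then have "L2_inner D F v = 0"
    unfolding L2_inner_def by (intro integral_eq_zero_AE) auto
  then show ?thesis
    using mult_nonneg_nonneg[OF F(2) L2_norm_nonneg] by simp
next
  case False
  have "L2_norm D (weak_grad D v) \<noteq> 0"
  proof
    assume "L2_norm D (weak_grad D v) = 0"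
    from H1_0_zero_gradient[OF D v this] False show False
      by (rule notE[rotated])
  qed
  then have pos: "L2_norm D (weak_grad D v) > 0"
    using L2_norm_nonneg[of D "weak_grad D v"] by simp
  have "ennreal (L2_inner D F v / L2_norm D (weak_grad D v)) \<le> Hm1_norm D F"
    unfolding Hm1_norm_def by (rule SUP_upper) (rule CollectI, rule conjI, rule v, rule False)
  then have "L2_inner D F v / L2_norm D (weak_grad D v) \<le> r"
    using F by (meson ennreal_le_iff order_trans)
  then show ?thesis
    using pos by (simp add: divide_le_eq)
qed

section \<open>Measurability of the energy norms\<close>

text \<open>
  Gaussian elimination combined with the Gram-Schmidt process, by induction on the number of
  spanning functions \<open>b k\<close>. The elements of \<open>V\<close> that do without the
  new \<open>b k\<close> form a subspace \<open>V'\<close> of codimension at most one. If it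
  is proper, the residual \<open>u\<close> of some element of \<open>V\<close> outside
  \<open>V'\<close> is orthogonal to \<open>V'\<close>, and \<open>u /
  \<parallel>u\<parallel>\<close> completes the family.

  Stating the expansion only almost everywhere and without orthonormality avoids a case
  distinction: if \<open>u\<close> is a null function, division by \<open>0\<close> adds the
  harmless function \<open>0\<close> to the family.
\<close>

lemma reproducing_family:
  fixes D :: "(real^'d) set" and b :: "'k \<Rightarrow> real^'d \<Rightarrow> real"
  assumes "finite I" and "V \<subseteq> L2 D" and "\<And>u v \<alpha> \<beta>. u \<in> V \<Longrightarrow> v \<in> V \<Longrightarrow> (\<lambda>x. \<alpha> * u x + \<beta> * v x) \<in> V"
    and "\<And>v. v \<in> V \<Longrightarrow> \<exists>c. \<forall>x\<in>D. v x = (\<Sum>k\<in>I. c k * b k x)"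
  shows "\<exists>(n::nat) e. (\<forall>i<n. e i \<in> V) \<and>
    (\<forall>v\<in>V. AE x in lebesgue_on D. v x = (\<Sum>i<n. L2_inner D v (e i) * e i x))"
  using assms
proof (induction I arbitrary: V rule: finite_induct)
  case empty
  then show ?case
    by (intro exI[of _ 0]) (auto intro!: AE_I2)
next
  case (insert k I)
  define V' where "V' = {v \<in> V. \<exists>c. \<forall>x\<in>D. v x = (\<Sum>k\<in>I. c k * b k x)}"
  have V'I: "v \<in> V'" if "v \<in> V" "\<forall>x\<in>D. v x = (\<Sum>k\<in>I. c k * b k x)" for v c
    unfolding V'_def mem_Collect_eq using that by (intro conjI exI)
  have V'_lin: "(\<lambda>x. \<alpha> * u x + \<beta> * v x) \<in> V'" if uv: "u \<in> V'" "v \<in> V'" for u v \<alpha> \<beta>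
  proof -
    obtain c c' where "\<forall>x\<in>D. u x = (\<Sum>k\<in>I. c k * b k x)" "\<forall>x\<in>D. v x = (\<Sum>k\<in>I. c' k * b k x)"
      using uv by (auto simp: V'_def)
    then have "\<forall>x\<in>D. \<alpha> * u x + \<beta> * v x = (\<Sum>k\<in>I. (\<alpha> * c k + \<beta> * c' k) * b k x)"
      by (simp add: sum_distrib_left sum.distrib distrib_right mult.assoc)
    then show ?thesis
      using uv unfolding V'_def by (intro V'I[unfolded V'_def] insert.prems(2)) blast+
  qed
  have "V' \<subseteq> V"
    by (auto simp: V'_def)
  have "\<exists>(n::nat) e. (\<forall>i<n. e i \<in> V') \<and>
      (\<forall>v\<in>V'. AE x in lebesgue_on D. v x = (\<Sum>i<n. L2_inner D v (e i) * e i x))"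
  proof (rule insert.IH)
    show "V' \<subseteq> L2 D"
      using \<open>V' \<subseteq> V\<close> insert.prems(1) by (rule subset_trans)
    show "\<exists>c. \<forall>x\<in>D. v x = (\<Sum>k\<in>I. c k * b k x)" if "v \<in> V'" for v
      using that unfolding V'_def mem_Collect_eq by (rule conjunct2)
  qed (rule V'_lin)
  then obtain n :: nat and e where e: "\<And>i. i < n \<Longrightarrow> e i \<in> V'"
    and rep: "\<And>v. v \<in> V' \<Longrightarrow> AE x in lebesgue_on D. v x = (\<Sum>i<n. L2_inner D v (e i) * e i x)"
    by (elim exE conjE) blast
  show ?case
  proof (cases "V \<subseteq> V'")
    case True
    then show ?thesis
      using e rep \<open>V' \<subseteq> V\<close> by (intro exI[of _ n] exI[of _ e]) auto
  next
    case False
    then obtain v0 where v0: "v0 \<in> V" "v0 \<notin> V'"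
      by blast
    note L2 = subsetD[OF insert.prems(1)]
    have eL2: "e i \<in> L2 D" if "i < n" for i
      using e[OF that] \<open>V' \<subseteq> V\<close> L2 by blast
    obtain c0 where c0: "\<forall>x\<in>D. v0 x = (\<Sum>k\<in>insert k I. c0 k * b k x)"
      using insert.prems(3)[OF v0(1)] by blast
    have "c0 k \<noteq> 0"
    proof
      assume "c0 k = 0"
      then have "\<forall>x\<in>D. v0 x = (\<Sum>k\<in>I. c0 k * b k x)"
        using c0 insert.hyps by simp
      from V'I[OF v0(1) this] v0(2) show False
        by contradiction
    qed
    have split: "\<exists>\<alpha>. (\<lambda>x. v x - \<alpha> * v0 x) \<in> V'" if v: "v \<in> V" for v
    proof -
      obtain c where c: "\<forall>x\<in>D. v x = (\<Sum>k\<in>insert k I. c k * b k x)"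
        using insert.prems(3)[OF v] by blast
      define \<alpha> where "\<alpha> = c k / c0 k"
      have "\<forall>x\<in>D. v x - \<alpha> * v0 x = (\<Sum>k\<in>I. (c k - \<alpha> * c0 k) * b k x)"
        using c c0 insert.hyps \<open>c0 k \<noteq> 0\<close>
        by (simp add: \<alpha>_def sum_distrib_left sum_subtractf left_diff_distrib distrib_left mult.assoc)
      moreover have "(\<lambda>x. v x - \<alpha> * v0 x) \<in> V"
        using insert.prems(2)[OF v v0(1), of 1 "- \<alpha>"] by simp
      ultimately show ?thesis
        by (intro exI[of _ \<alpha>] V'I)
    qed
    have V'_0: "(\<lambda>x. 0) \<in> V'"
    proof -
      have "(\<lambda>x. 0 * v0 x + 0 * v0 x) \<in> V"
        by (intro insert.prems(2) v0)
      then show ?thesis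
        by (intro V'I[where c = "\<lambda>_. 0"]) simp_all
    qed
    have V'_sum: "(\<lambda>x. \<Sum>i<j. d i * e i x) \<in> V'" if "j \<le> n" for j and d :: "nat \<Rightarrow> real"
      using that
    proof (induction j)
      case (Suc j)
      then show ?case
        using V'_lin[of "\<lambda>x. \<Sum>i<j. d i * e i x" "e j" 1 "d j"] e by simp
    qed (simp add: V'_0)
    define p where "p = (\<lambda>x. \<Sum>i<n. L2_inner D v0 (e i) * e i x)"
    define u where "u = (\<lambda>x. 1 * v0 x + (- 1) * p x)"
    have p: "p \<in> V'"
      unfolding p_def by (intro V'_sum) simp
    then have u: "u \<in> V"
      unfolding u_def using \<open>V' \<subseteq> V\<close> by (intro insert.prems(2) v0) auto
    have rep_inner: "L2_inner D w g = (\<Sum>i<n. L2_inner D w (e i) * L2_inner D (e i) g)"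
      if "w \<in> V'" "g \<in> L2 D" for w g
    proof -
      have "(\<lambda>x. \<Sum>i<n. L2_inner D w (e i) * e i x) \<in> L2 D"
        by (rule L2[OF subsetD[OF \<open>V' \<subseteq> V\<close> V'_sum]]) simp
      then have "L2_inner D w g = L2_inner D (\<lambda>x. \<Sum>i<n. L2_inner D w (e i) * e i x) g"
        using that \<open>V' \<subseteq> V\<close> L2 by (intro L2_inner_cong_AE rep) auto
      also have "\<dots> = (\<Sum>i<n. L2_inner D w (e i) * L2_inner D (e i) g)"
        using L2_inner_sum_left[of "{..<n}" e D g "\<lambda>i. L2_inner D w (e i)"] eL2 that by simp
      finally show ?thesis .
    qed
    have lin: "L2_inner D (\<lambda>x. \<alpha> * g x + \<beta> * g' x) h = \<alpha> * L2_inner D g h + \<beta> * L2_inner D g' h"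
      if "g \<in> V" "g' \<in> V" "h \<in> V" for g g' h \<alpha> \<beta>
      using L2_inner_lincomb_left[of g D g' h \<alpha> \<beta>] that L2 by simp
    have eV: "e i \<in> V" if "i < n" for i
      using e[OF that] \<open>V' \<subseteq> V\<close> by blast
    have u_e: "L2_inner D u (e j) = 0" if "j < n" for j
    proof -
      have "L2_inner D p (e j) = (\<Sum>i<n. L2_inner D v0 (e i) * L2_inner D (e i) (e j))"
        unfolding p_def
        using L2_inner_sum_left[of "{..<n}" e D "e j" "\<lambda>i. L2_inner D v0 (e i)"] eL2 that by simp
      also have "\<dots> = (\<Sum>i<n. L2_inner D (e j) (e i) * L2_inner D (e i) v0)"
        by (intro sum.cong) (simp_all add: L2_inner_commute mult.commute)
      also have "\<dots> = L2_inner D v0 (e j)"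
        using rep_inner[OF e[OF that] L2[OF v0(1)]] by (simp add: L2_inner_commute)
      finally show ?thesis
        unfolding u_def lin[OF v0(1) subsetD[OF \<open>V' \<subseteq> V\<close> p] eV[OF that]] by simp
    qed
    \<comment> \<open>the summand \<open>0 * u x\<close> gives the new element the form of the closure assumption on \<open>V\<close>\<close>
    define e' where "e' = e(n := \<lambda>x. (1 / L2_norm D u) * u x + 0 * u x)"
    have e'_n: "e' n \<in> V"
      unfolding e'_def fun_upd_same by (intro insert.prems(2) u)
    have "AE x in lebesgue_on D. v x = (\<Sum>i<Suc n. L2_inner D v (e' i) * e' i x)" if v: "v \<in> V" for v
    proof -
      obtain \<alpha> where \<alpha>: "(\<lambda>x. v x - \<alpha> * v0 x) \<in> V'"
        using split[OF v] by blast
      define w where "w = (\<lambda>x. 1 * (v x - \<alpha> * v0 x) + \<alpha> * p x)"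
      have w: "w \<in> V'"
        unfolding w_def by (intro V'_lin \<alpha> p)
      then have wV: "w \<in> V"
        using \<open>V' \<subseteq> V\<close> by blast
      have v_eq: "v = (\<lambda>x. \<alpha> * u x + 1 * w x)"
        by (simp add: u_def w_def fun_eq_iff algebra_simps)
      have "L2_inner D w u = 0"
        using rep_inner[OF w L2[OF u]] u_e by (simp add: L2_inner_commute[of D "e _" u])
      then have v_u: "L2_inner D v u = \<alpha> * (L2_norm D u)\<^sup>2"
        unfolding v_eq by (subst lin[OF u wV u]) (simp add: L2_norm_square)
      have v_e: "L2_inner D v (e i) = L2_inner D w (e i)" if "i < n" for i
        unfolding v_eq by (subst lin[OF u wV eV[OF that]]) (simp add: u_e that)
      have "L2_inner D v (e' n) = L2_inner D (e' n) v"
        by (rule L2_inner_commute)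
      also have "\<dots> = (1 / L2_norm D u) * L2_inner D v u"
        unfolding e'_def fun_upd_same by (subst lin[OF u u v]) (simp add: L2_inner_commute)
      finally have v_e': "L2_inner D v (e' n) = \<alpha> * L2_norm D u"
        by (simp add: v_u power2_eq_square)
      have "AE x in lebesgue_on D. L2_norm D u = 0 \<longrightarrow> u x = 0"
      proof (cases "L2_norm D u = 0")
        case True
        then have "L2_inner D u u = 0"
          using L2_norm_square[of D u] by simp
        then show ?thesis
          using L2_inner_self_eq_0_iff[OF L2[OF u]] by simp
      qed simp
      with rep[OF w] show ?thesis
      proof eventually_elim
        case (elim x)
        have "(\<Sum>i<Suc n. L2_inner D v (e' i) * e' i x) =
            (\<Sum>i<n. L2_inner D w (e i) * e i x) + \<alpha> * L2_norm D u * (u x / L2_norm D u)"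
          using v_e v_e' by (simp add: e'_def)
        also have "\<dots> = w x + \<alpha> * u x"
          using elim by (cases "L2_norm D u = 0") auto
        finally show ?case
          by (simp add: v_eq)
      qed
    qed
    moreover have "e' i \<in> V" if "i < Suc n" for i
      using that e'_n eV[of i] by (cases "i = n") (auto simp: e'_def)
    ultimately show ?thesis
      by blast
  qed
qed

text \<open>
  Larger than the finite element space, since no boundary condition is imposed. Closure under
  linear combinations then follows from that of \<open>H1 D\<close>, without the approximation
  by test functions.
\<close>

definition piecewise_poly_H1 :: "(real^'d) set \<Rightarrow> (real^'d) set set \<Rightarrow> nat \<Rightarrow> (real^'d \<Rightarrow> real) set" where
  "piecewise_poly_H1 D \<T> m = {v \<in> H1 D. \<forall>K\<in>\<T>. \<exists>p. poly_deg_le m p \<and> (\<forall>x\<in>K. v x = p x)}"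

lemma fe_space_subset: "fe_space D \<T> m \<subseteq> piecewise_poly_H1 D \<T> m"
  by (auto simp: fe_space_def piecewise_poly_H1_def H1_0_H1)

lemma H1_lincomb:
  fixes D :: "(real^'d) set"
  assumes D: "open D" "bounded D" and "u \<in> H1 D" "v \<in> H1 D"
  shows "(\<lambda>x. \<alpha> * u x + \<beta> * v x) \<in> H1 D"
    and "AE x in lebesgue_on D. weak_grad D (\<lambda>x. \<alpha> * u x + \<beta> * v x) x =
      \<alpha> *\<^sub>R weak_grad D u x + \<beta> *\<^sub>R weak_grad D v x"
proof -
  define w where "w b = (if b then u else v)" for b
  define c where "c b = (if b then \<alpha> else \<beta>)" for b
  have w: "w b \<in> H1 D" for b
    using assms(3,4) by (simp add: w_def)
  have eq: "(\<lambda>x. \<Sum>b\<in>UNIV. c b * w b x) = (\<lambda>x. \<alpha> * u x + \<beta> * v x)"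
    by (simp add: UNIV_bool w_def c_def add.commute)
  show H1: "(\<lambda>x. \<alpha> * u x + \<beta> * v x) \<in> H1 D"
    using H1_sum[where I = UNIV and c = c and v = w, OF D w] unfolding eq .
  have "AE x in lebesgue_on D. weak_grad D (\<lambda>x. \<alpha> * u x + \<beta> * v x) x = (\<Sum>b\<in>UNIV. c b *\<^sub>R weak_grad D (w b) x)"
    by (rule weak_grad_sum_AE[OF D w H1]) (simp add: UNIV_bool w_def c_def add.commute)
  then show "AE x in lebesgue_on D. weak_grad D (\<lambda>x. \<alpha> * u x + \<beta> * v x) x =
      \<alpha> *\<^sub>R weak_grad D u x + \<beta> *\<^sub>R weak_grad D v x"
    by (simp add: UNIV_bool w_def c_def add.commute)
qed

lemma poly_deg_le_lincomb:
  assumes "poly_deg_le m p" "poly_deg_le m q"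
  shows "poly_deg_le m (\<lambda>x. \<alpha> * p x + \<beta> * q x)"
proof -
  let ?A = "{\<alpha> :: 'a \<Rightarrow> nat. (\<Sum>i\<in>UNIV. \<alpha> i) \<le> m}"
  obtain c d where "\<And>x. p x = (\<Sum>a\<in>?A. c a * (\<Prod>i\<in>UNIV. (x $ i) ^ a i))"
    "\<And>x. q x = (\<Sum>a\<in>?A. d a * (\<Prod>i\<in>UNIV. (x $ i) ^ a i))"
    using assms unfolding poly_deg_le_def by blast
  then have "\<forall>x. \<alpha> * p x + \<beta> * q x = (\<Sum>a\<in>?A. (\<alpha> * c a + \<beta> * d a) * (\<Prod>i\<in>UNIV. (x $ i) ^ a i))"
    by (simp add: sum_distrib_left sum.distrib distrib_right mult.assoc)
  then show ?thesis
    unfolding poly_deg_le_def by (rule exI[where x = "\<lambda>a. \<alpha> * c a + \<beta> * d a"])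
qed

lemma piecewise_poly_H1_lincomb:
  fixes D :: "(real^'d) set"
  assumes D: "open D" "bounded D" and uv: "u \<in> piecewise_poly_H1 D \<T> m" "v \<in> piecewise_poly_H1 D \<T> m"
  shows "(\<lambda>x. \<alpha> * u x + \<beta> * v x) \<in> piecewise_poly_H1 D \<T> m"
  unfolding piecewise_poly_H1_def
proof (intro CollectI conjI ballI)
  show "(\<lambda>x. \<alpha> * u x + \<beta> * v x) \<in> H1 D"
    using uv by (intro H1_lincomb(1)[OF D]) (auto simp: piecewise_poly_H1_def)
  fix K assume "K \<in> \<T>"
  then obtain p q where p: "poly_deg_le m p" "\<forall>x\<in>K. u x = p x" and q: "poly_deg_le m q" "\<forall>x\<in>K. v x = q x"
    using uv unfolding piecewise_poly_H1_def by blast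
  show "\<exists>p. poly_deg_le m p \<and> (\<forall>x\<in>K. \<alpha> * u x + \<beta> * v x = p x)"
    by (intro exI[of _ "\<lambda>x. \<alpha> * p x + \<beta> * q x"] conjI poly_deg_le_lincomb p(1) q(1)) (simp add: p(2) q(2))
qed

lemma finite_multi_indices: "finite {\<alpha> :: 'd::finite \<Rightarrow> nat. (\<Sum>i\<in>UNIV. \<alpha> i) \<le> m}"
proof (rule finite_subset)
  show "{\<alpha> :: 'd \<Rightarrow> nat. (\<Sum>i\<in>UNIV. \<alpha> i) \<le> m} \<subseteq> (UNIV \<rightarrow>\<^sub>E {..m})"
  proof
    fix \<alpha> :: "'d \<Rightarrow> nat" assume "\<alpha> \<in> {\<alpha>. (\<Sum>i\<in>UNIV. \<alpha> i) \<le> m}"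
    moreover have "\<alpha> i \<le> (\<Sum>i\<in>UNIV. \<alpha> i)" for i
      by (rule member_le_sum) auto
    ultimately show "\<alpha> \<in> UNIV \<rightarrow>\<^sub>E {..m}"
      by (auto intro: order_trans)
  qed
qed (simp add: finite_PiE)

text \<open>
  A point may lie in several cells. Assigning it to one of them turns each function into a
  combination of monomials cut off to single cells; the cut-off need not be measurable,
  because only linear algebra is done with these functions.
\<close>

lemma piecewise_poly_H1_spanned:
  fixes D :: "(real^'d) set"
  assumes \<T>: "finite \<T>" "D \<subseteq> \<Union>\<T>"
  shows "\<exists>(I :: ((real^'d) set \<times> ('d \<Rightarrow> nat)) set) b. finite I \<and>
    (\<forall>v\<in>piecewise_poly_H1 D \<T> m. \<exists>c. \<forall>x\<in>D. v x = (\<Sum>k\<in>I. c k * b k x))"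
proof -
  let ?A = "{\<alpha> :: 'd \<Rightarrow> nat. (\<Sum>i\<in>UNIV. \<alpha> i) \<le> m}"
  define cell where "cell x = (SOME K. K \<in> \<T> \<and> x \<in> K)" for x
  have cell: "cell x \<in> \<T>" "x \<in> cell x" if "x \<in> D" for x
    using someI_ex[of "\<lambda>K. K \<in> \<T> \<and> x \<in> K"] that \<T>(2) unfolding cell_def by blast+
  define b where "b = (\<lambda>(K, \<alpha>) x. if cell x = K then (\<Prod>i\<in>UNIV. (x $ i) ^ \<alpha> i) else 0)"
  have "\<exists>c. \<forall>x\<in>D. v x = (\<Sum>k\<in>\<T> \<times> ?A. c k * b k x)" if v: "v \<in> piecewise_poly_H1 D \<T> m" for v
  proof -
    have "\<forall>K\<in>\<T>. \<exists>c. \<forall>x\<in>K. v x = (\<Sum>\<alpha>\<in>?A. c \<alpha> * (\<Prod>i\<in>UNIV. (x $ i) ^ \<alpha> i))"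
      using v unfolding piecewise_poly_H1_def poly_deg_le_def by fastforce
    from bchoice[OF this] obtain c
      where c: "\<forall>K\<in>\<T>. \<forall>x\<in>K. v x = (\<Sum>\<alpha>\<in>?A. c K \<alpha> * (\<Prod>i\<in>UNIV. (x $ i) ^ \<alpha> i))" ..
    have "v x = (\<Sum>k\<in>\<T> \<times> ?A. case_prod c k * b k x)" if "x \<in> D" for x
    proof -
      have "(\<Sum>k\<in>\<T> \<times> ?A. case_prod c k * b k x) = (\<Sum>K\<in>\<T>. \<Sum>\<alpha>\<in>?A. c K \<alpha> * b (K, \<alpha>) x)"
        by (simp add: sum.cartesian_product split_beta)
      also have "\<dots> = (\<Sum>K\<in>\<T>. if cell x = K then (\<Sum>\<alpha>\<in>?A. c K \<alpha> * (\<Prod>i\<in>UNIV. (x $ i) ^ \<alpha> i)) else 0)"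
        by (intro sum.cong refl) (simp add: b_def)
      also have "\<dots> = v x"
        using c[rule_format, OF cell[OF that]] cell(1)[OF that] \<T>(1) by simp
      finally show ?thesis
        by simp
    qed
    then show ?thesis
      by blast
  qed
  moreover have "finite (\<T> \<times> ?A)"
    using \<T>(1) finite_multi_indices by blast
  ultimately show ?thesis
    by blast
qed

lemma borel_measurable_lebesgue_on:
  fixes g :: "real^'d \<Rightarrow> real"
  assumes "open D" "g \<in> borel_measurable (restrict_space borel D)"
  shows "g \<in> borel_measurable (lebesgue_on D)"
proof -
  have "(\<lambda>x. indicator D x *\<^sub>R g x) \<in> borel_measurable borel"
    using assms by (subst (asm) borel_measurable_restrict_space_iff) auto
  then have "(\<lambda>x. indicator D x *\<^sub>R g x) \<in> borel_measurable lebesgue"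
    by (simp add: measurable_completion)
  then show ?thesis
    using open_sets_lebesgue[OF assms(1)] by (subst borel_measurable_restrict_space_iff) auto
qed

lemma integral_lebesgue_on_borel:
  fixes g :: "real^'d \<Rightarrow> real"
  assumes "open D" "g \<in> borel_measurable (restrict_space borel D)"
  shows "(LINT x|lebesgue_on D. g x) = (LINT x|restrict_space lborel D. g x)"
proof -
  have m: "(\<lambda>x. indicator D x *\<^sub>R g x) \<in> borel_measurable borel"
    using assms by (subst (asm) borel_measurable_restrict_space_iff) auto
  have "(LINT x|lebesgue_on D. g x) = (LINT x|lebesgue. indicator D x *\<^sub>R g x)"
    using open_sets_lebesgue[OF assms(1)] by (subst integral_restrict_space) auto
  also have "\<dots> = (LINT x|lborel. indicator D x *\<^sub>R g x)"
    using m by (intro integral_completion) simp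
  also have "\<dots> = (LINT x|restrict_space lborel D. g x)"
    using assms(1) by (subst integral_restrict_space) auto
  finally show ?thesis .
qed

lemma measurable_integral_lebesgue_on:
  fixes G :: "'s \<Rightarrow> real^'d \<Rightarrow> real"
  assumes D: "open D" "bounded D" and G: "(\<lambda>(s, x). G s x) \<in> borel_measurable (Q \<Otimes>\<^sub>M restrict_space borel D)"
  shows "(\<lambda>s. LINT x|lebesgue_on D. G s x) \<in> borel_measurable Q"
proof -
  have "emeasure lborel D < \<infinity>"
    using D(2) by (rule emeasure_bounded_finite)
  then have "finite_measure (restrict_space lborel D)"
    using D(1) by (intro finite_measure_restrict_space finite_measureI) (auto simp: emeasure_restrict_space)
  then interpret finite_measure "restrict_space lborel D" .
  have [measurable_cong]: "sets (restrict_space lborel D) = sets (restrict_space borel D)"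
    by (rule sets_restrict_space_cong) simp
  have "(\<lambda>(s, x). G s x) \<in> borel_measurable (Q \<Otimes>\<^sub>M restrict_space lborel D)"
    using G by measurable
  then have "(\<lambda>s. LINT x|restrict_space lborel D. G s x) \<in> borel_measurable Q"
    by (rule borel_measurable_lebesgue_integral)
  moreover have "(LINT x|lebesgue_on D. G s x) = (LINT x|restrict_space lborel D. G s x)" if "s \<in> space Q" for s
    using measurable_compose[OF measurable_Pair1'[OF that] G]
    by (intro integral_lebesgue_on_borel[OF D(1)]) simp
  ultimately show ?thesis
    by (simp cong: measurable_cong)
qed

text \<open>
  As \<open>h\<close> is only Lebesgue measurable, the integrand is not measurable on the
  product space. Replacing \<open>h\<close> by a Borel function that agrees with it almost
  everywhere does not change the integral.
\<close>

lemma measurable_L2_inner: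
  fixes U :: "'s \<Rightarrow> real^'d \<Rightarrow> real"
  assumes D: "open D" "bounded D" and U: "(\<lambda>(s, x). U s x) \<in> borel_measurable (Q \<Otimes>\<^sub>M restrict_space borel D)"
    and h: "h \<in> L2 D"
  shows "(\<lambda>s. L2_inner D (U s) h) \<in> borel_measurable Q"
proof -
  have "(\<lambda>x. if x \<in> D then h x else 0) \<in> borel_measurable lebesgue"
    using L2_measurable[OF h] open_sets_lebesgue[OF D(1)] by (rule borel_measurable_if_I)
  then obtain h' where h': "h' \<in> borel_measurable lborel" "AE x in lborel. (if x \<in> D then h x else 0) = h' x"
    using completion_ex_borel_measurable_real by blast
  have AE: "AE x in lebesgue_on D. h x = h' x"
    using AE_completion[OF h'(2)] open_sets_lebesgue[OF D(1)]
    by (subst AE_restrict_space_iff) (auto elim!: eventually_mono split: if_splits)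
  have [measurable]: "h' \<in> borel_measurable (restrict_space borel D)"
    using h'(1) by (simp add: measurable_restrict_space1)
  have "(\<lambda>(s, x). U s x * h' x) \<in> borel_measurable (Q \<Otimes>\<^sub>M restrict_space borel D)"
    using U by (simp add: split_beta) 
  then have "(\<lambda>s. LINT x|lebesgue_on D. U s x * h' x) \<in> borel_measurable Q"
    by (rule measurable_integral_lebesgue_on[OF D])
  moreover have "L2_inner D (U s) h = (LINT x|lebesgue_on D. U s x * h' x)" if "s \<in> space Q" for s
    unfolding L2_inner_def
  proof (rule integral_cong_AE)
    have "U s \<in> borel_measurable (restrict_space borel D)"
      using measurable_compose[OF measurable_Pair1'[OF that] U] by simp
    then have "U s \<in> borel_measurable (lebesgue_on D)"
      by (rule borel_measurable_lebesgue_on[OF D(1)])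
    moreover have "h' \<in> borel_measurable (lebesgue_on D)"
      by (rule borel_measurable_lebesgue_on[OF D(1)]) measurable
    ultimately show "(\<lambda>x. U s x \<bullet> h x) \<in> borel_measurable (lebesgue_on D)"
      "(\<lambda>x. U s x * h' x) \<in> borel_measurable (lebesgue_on D)"
      using L2_measurable[OF h] by auto
    show "AE x in lebesgue_on D. U s x \<bullet> h x = U s x * h' x"
      using AE by eventually_elim simp
  qed
  ultimately show ?thesis
    by (simp cong: measurable_cong)
qed

lemma measurable_L2_norm_square:
  fixes U :: "'s \<Rightarrow> real^'d \<Rightarrow> real"
  assumes D: "open D" "bounded D" and U: "(\<lambda>(s, x). U s x) \<in> borel_measurable (Q \<Otimes>\<^sub>M restrict_space borel D)"
  shows "(\<lambda>s. (L2_norm D (U s))\<^sup>2) \<in> borel_measurable Q"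
  unfolding L2_norm_square L2_inner_def
  by (rule measurable_integral_lebesgue_on[OF D]) (use U in \<open>simp add: split_beta\<close>)

text \<open>
  Expanding in a reproducing family \<open>e\<close> gives
  \<open>\<parallel>\<nabla>U\<parallel>\<^sup>2 = \<Sum>\<^sub>i \<Sum>\<^sub>j (U,
  e\<^sub>i) (U, e\<^sub>j) (\<nabla>e\<^sub>i, \<nabla>e\<^sub>j)\<close>, where only the
  first two factors depend on \<open>s\<close>. The identity is claimed only where \<open>U
  s\<close> belongs to the finite-dimensional space, which a solution of the scheme does
  almost surely.
\<close>

lemma measurable_gradient_norm_square:
  fixes U :: "'s \<Rightarrow> real^'d \<Rightarrow> real"
  assumes D: "open D" "bounded D" and \<T>: "finite \<T>" "D \<subseteq> \<Union>\<T>"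
    and U: "(\<lambda>(s, x). U s x) \<in> borel_measurable (Q \<Otimes>\<^sub>M restrict_space borel D)"
  shows "\<exists>g \<in> borel_measurable Q. \<forall>s. U s \<in> piecewise_poly_H1 D \<T> m \<longrightarrow> (L2_norm D (weak_grad D (U s)))\<^sup>2 = g s"
proof -
  let ?V = "piecewise_poly_H1 D \<T> m"
  obtain I :: "((real^'d) set \<times> ('d \<Rightarrow> nat)) set" and b where I: "finite I"
    "\<And>v. v \<in> ?V \<Longrightarrow> \<exists>c. \<forall>x\<in>D. v x = (\<Sum>k\<in>I. c k * b k x)"
    using piecewise_poly_H1_spanned[OF \<T>, of m] by blast
  have H1: "v \<in> H1 D" if "v \<in> ?V" for v
    using that by (simp add: piecewise_poly_H1_def)
  have "\<exists>(n::nat) e. (\<forall>i<n. e i \<in> ?V) \<and>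
      (\<forall>v\<in>?V. AE x in lebesgue_on D. v x = (\<Sum>i<n. L2_inner D v (e i) * e i x))"
  proof (rule reproducing_family[OF I(1)])
    show "?V \<subseteq> L2 D"
      using H1 H1_L2 by blast
    show "(\<lambda>x. \<alpha> * u x + \<beta> * v x) \<in> ?V" if "u \<in> ?V" "v \<in> ?V" for u v \<alpha> \<beta>
      by (rule piecewise_poly_H1_lincomb[OF D that])
  qed (rule I(2))
  then obtain n :: nat and e where e: "\<And>i. i < n \<Longrightarrow> e i \<in> ?V"
    and rep: "\<And>v. v \<in> ?V \<Longrightarrow> AE x in lebesgue_on D. v x = (\<Sum>i<n. L2_inner D v (e i) * e i x)"
    by (elim exE conjE) blast
  define \<gamma> where "\<gamma> i j = L2_inner D (weak_grad D (e i)) (weak_grad D (e j))" for i j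
  define g where "g s = (\<Sum>i<n. \<Sum>j<n. L2_inner D (U s) (e i) * (L2_inner D (U s) (e j) * \<gamma> j i))" for s
  have "(\<lambda>s. L2_inner D (U s) (e i)) \<in> borel_measurable Q" if "i < n" for i
    by (rule measurable_L2_inner[OF D U H1_L2[OF H1[OF e[OF that]]]])
  then have "g \<in> borel_measurable Q"
    unfolding g_def by (intro borel_measurable_sum borel_measurable_times) auto
  moreover have "(L2_norm D (weak_grad D (U s)))\<^sup>2 = g s" if s: "U s \<in> ?V" for s
  proof -
    let ?c = "\<lambda>i. L2_inner D (U s) (e i)" and ?G = "\<lambda>i. weak_grad D (e i)"
    let ?S = "\<lambda>x. \<Sum>i<n. ?c i *\<^sub>R ?G i x"
    have eH1: "e i \<in> H1 D" if "i \<in> {..<n}" for i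
      using that e H1 by simp
    have GL2: "?G i \<in> L2 D" if "i \<in> {..<n}" for i
      using weak_grad_H1(1)[OF eH1[OF that]] .
    have UL2: "weak_grad D (U s) \<in> L2 D"
      by (rule weak_grad_H1(1)[OF H1[OF s]])
    have S: "?S \<in> L2 D"
      using GL2 by (rule L2_sum)
    have eq: "AE x in lebesgue_on D. weak_grad D (U s) x = ?S x"
      by (rule weak_grad_sum_AE[OF D eH1 H1[OF s] rep[OF s]])
    have "L2_inner D (weak_grad D (U s)) (weak_grad D (U s)) = L2_inner D ?S (weak_grad D (U s))"
      by (rule L2_inner_cong_AE[OF eq UL2 S UL2])
    also have "\<dots> = L2_inner D (weak_grad D (U s)) ?S"
      by (rule L2_inner_commute)
    also have "\<dots> = L2_inner D ?S ?S"
      by (rule L2_inner_cong_AE[OF eq UL2 S S])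
    also have "\<dots> = (\<Sum>i<n. ?c i * L2_inner D (?G i) ?S)"
      by (rule L2_inner_sum_left[OF GL2 S])
    also have "\<dots> = (\<Sum>i<n. ?c i * (\<Sum>j<n. ?c j * L2_inner D (?G j) (?G i)))"
      by (intro sum.cong refl arg_cong2[where f = "(*)"], subst L2_inner_commute) (rule L2_inner_sum_left[OF GL2 GL2])
    finally show ?thesis
      by (simp add: L2_norm_square g_def \<gamma>_def sum_distrib_left)
  qed
  ultimately show ?thesis
    by blast
qed

section \<open>One time step\<close>

text \<open>
  Summation of the one-step estimates, written as an induction. The left-hand side carries the
  additional term \<open>\<theta>/6 A (k - 1)\<close>: one step leaves over \<open>\<theta>p/2
  A (k - 1)\<close>, which this term absorbs since \<open>3 \<theta>p \<le> \<theta>\<close>.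
  Its value for \<open>k = 1\<close> is the term with the initial gradient in the final
  estimate.
\<close>

lemma BDF2_recursion:
  fixes E A R :: "nat \<Rightarrow> real"
  assumes \<theta>: "3 * \<theta>p \<le> \<theta>" and \<tau>: "0 \<le> \<tau>" and A: "\<And>n. 0 \<le> A n"
    and step: "\<And>n. 1 \<le> n \<Longrightarrow> n < N \<Longrightarrow>
      E (n + 1) + \<tau> * (\<theta>/2 * A (n + 1) - \<theta>p * A n - \<theta>p/2 * A (n - 1)) \<le> E n + R n"
    and "1 \<le> k" "k \<le> N"
  shows "E k + \<tau> * (\<theta>/2 * A k + \<theta>/6 * A (k - 1)) + (\<theta>/3 - \<theta>p) * \<tau> * (\<Sum>n=1..k - 1. A n) \<le>
    (\<Sum>n=1..k - 1. R n) + E 1 + \<tau> * (\<theta>/2 * A 1 + \<theta>/6 * A 0)"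
  using \<open>1 \<le> k\<close> \<open>k \<le> N\<close>
proof (induction k rule: dec_induct)
  case base
  then show ?case by simp
next
  case (step k)
  obtain j where j: "k = Suc j"
    using step.hyps by (cases k) auto
  have "\<tau> * ((\<theta>/6 - \<theta>p/2) * A (k - 1)) \<ge> 0"
    using \<theta> \<tau> A by (intro mult_nonneg_nonneg) auto
  moreover have "E (k + 1) + \<tau> * (\<theta>/2 * A (k + 1) - \<theta>p * A k - \<theta>p/2 * A (k - 1)) \<le> E k + R k"
    using step.hyps step.prems by (intro assms(4)) auto
  moreover have "E k + \<tau> * (\<theta>/2 * A k + \<theta>/6 * A (k - 1)) + (\<theta>/3 - \<theta>p) * \<tau> * (\<Sum>n=1..k - 1. A n) \<le>
    (\<Sum>n=1..k - 1. R n) + E 1 + \<tau> * (\<theta>/2 * A 1 + \<theta>/6 * A 0)"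
    using step.IH step.prems by simp
  ultimately show ?case
    by (simp add: j algebra_simps)
qed

text \<open>
  Pointwise, \<open>2 (3u - 4v + w) u = u\<^sup>2 + (2u - v)\<^sup>2 - v\<^sup>2 - (2v -
  w)\<^sup>2 + (u - 2v + w)\<^sup>2\<close>; the last square is dropped.
\<close>

lemma L2_inner_BDF2_ge:
  fixes D :: "(real^'d) set" and u v w :: "real^'d \<Rightarrow> real"
  assumes \<tau>: "\<tau> > 0" and L2: "u \<in> L2 D" "v \<in> L2 D" "w \<in> L2 D"
  shows "1/4 * ((L2_norm D u)\<^sup>2 + (L2_norm D (\<lambda>x. 2 * u x - v x))\<^sup>2)
       - 1/4 * ((L2_norm D v)\<^sup>2 + (L2_norm D (\<lambda>x. 2 * v x - w x))\<^sup>2)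
    \<le> \<tau> * L2_inner D (\<lambda>x. (3 * u x - 4 * v x + w x) / (2 * \<tau>)) u"
proof -
  have L2': "(\<lambda>x. 2 * u x - v x) \<in> L2 D" "(\<lambda>x. 2 * v x - w x) \<in> L2 D"
    using L2_lincomb[OF L2(1,2), of 2 "-1"] L2_lincomb[OF L2(2,3), of 2 "-1"] by simp_all
  have "(\<lambda>x. (3 * u x - 4 * v x + w x) / (2 * \<tau>)) \<in> L2 D"
    using L2_lincomb[OF L2_lincomb[OF L2(1,2), of "3 / (2 * \<tau>)" "- 4 / (2 * \<tau>)"] L2(3), of 1 "1 / (2 * \<tau>)"]
    by (simp add: add_divide_distrib diff_divide_distrib)
  note int = integrable_L2_inner[OF L2(1) L2(1)] integrable_L2_inner[OF L2(2) L2(2)]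
    integrable_L2_inner[OF L2'(1) L2'(1)] integrable_L2_inner[OF L2'(2) L2'(2)]
    integrable_L2_inner[OF this L2(1)]
  have "1/4 * ((L2_norm D u)\<^sup>2 + (L2_norm D (\<lambda>x. 2 * u x - v x))\<^sup>2)
       - 1/4 * ((L2_norm D v)\<^sup>2 + (L2_norm D (\<lambda>x. 2 * v x - w x))\<^sup>2) =
     (LINT x|lebesgue_on D. 1/4 * (u x \<bullet> u x + (2 * u x - v x) \<bullet> (2 * u x - v x))
        - 1/4 * (v x \<bullet> v x + (2 * v x - w x) \<bullet> (2 * v x - w x)))"
    using int(1-4) by (simp add: L2_norm_square L2_inner_def)
  also have "\<dots> \<le> (LINT x|lebesgue_on D. \<tau> * (((3 * u x - 4 * v x + w x) / (2 * \<tau>)) \<bullet> u x))"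
  proof (rule integral_mono)
    show "1/4 * (u x \<bullet> u x + (2 * u x - v x) \<bullet> (2 * u x - v x))
        - 1/4 * (v x \<bullet> v x + (2 * v x - w x) \<bullet> (2 * v x - w x)) \<le> \<tau> * (((3 * u x - 4 * v x + w x) / (2 * \<tau>)) \<bullet> u x)" for x
    proof -
      have rhs: "\<tau> * (((3 * u x - 4 * v x + w x) / (2 * \<tau>)) \<bullet> u x) = (3 * u x - 4 * v x + w x) * u x / 2"
        using \<tau> by simp
      \<comment> \<open>the numerical dissipation of the two-step difference\<close>
      have "0 \<le> (u x - 2 * v x + w x)\<^sup>2"
        by simp
      then show ?thesis
        unfolding rhs by (simp add: power2_eq_square algebra_simps)
    qed
    show "integrable (lebesgue_on D) (\<lambda>x. \<tau> * (((3 * u x - 4 * v x + w x) / (2 * \<tau>)) \<bullet> u x))"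
      by (rule integrable_mult_right) (rule int(5))
  qed (use int(1-4) in simp)
  also have "(LINT x|lebesgue_on D. \<tau> * (((3 * u x - 4 * v x + w x) / (2 * \<tau>)) \<bullet> u x)) = \<tau> * L2_inner D (\<lambda>x. (3 * u x - 4 * v x + w x) / (2 * \<tau>)) u"
    unfolding L2_inner_def by (rule integral_mult_right_zero)
  finally show ?thesis .
qed

lemma L2_inner_coercive:
  fixes D :: "(real^'d) set" and g :: "real^'d \<Rightarrow> real^'d"
  assumes b: "b \<in> borel_measurable (lebesgue_on D)" "AE x in lebesgue_on D. \<bar>b x\<bar> \<le> C"
    and \<theta>: "AE x in lebesgue_on D. \<theta> \<le> b x" and g: "g \<in> L2 D"
  shows "\<theta> * (L2_norm D g)\<^sup>2 \<le> L2_inner D (\<lambda>x. b x *\<^sub>R g x) g"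
proof -
  note int = integrable_L2_inner[OF g g] integrable_L2_inner[OF L2_multiplier[OF b g] g]
  have "\<theta> * (L2_norm D g)\<^sup>2 = (LINT x|lebesgue_on D. \<theta> * (g x \<bullet> g x))"
    using int(1) by (simp add: L2_norm_square L2_inner_def)
  also have "\<dots> \<le> L2_inner D (\<lambda>x. b x *\<^sub>R g x) g"
    unfolding L2_inner_def
  proof (rule integral_mono_AE)
    show "AE x in lebesgue_on D. \<theta> * (g x \<bullet> g x) \<le> b x *\<^sub>R g x \<bullet> g x"
      using \<theta> by eventually_elim (simp add: mult_right_mono)
  qed (use int in simp_all)
  finally show ?thesis .
qed

text \<open>
  The extrapolated gradient \<open>w = 2 g1 - g0\<close> is paired with \<open>g2\<close> by
  \<open>2qp + rp \<le> q\<^sup>2 + p\<^sup>2 + (r\<^sup>2 + p\<^sup>2)/2\<close>. The three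
  weights add up to \<open>3\<close>, the factor in the stability condition.
\<close>

lemma L2_inner_extrapolation_bound:
  fixes D :: "(real^'d) set" and g :: "real^'d \<Rightarrow> real^'d"
  assumes b: "b \<in> borel_measurable (lebesgue_on D)" "AE x in lebesgue_on D. \<bar>b x\<bar> \<le> C" and C: "0 \<le> C"
    and L2: "g2 \<in> L2 D" "g1 \<in> L2 D" "g0 \<in> L2 D" "w \<in> L2 D"
    and w: "AE x in lebesgue_on D. w x = 2 *\<^sub>R g1 x + (-1) *\<^sub>R g0 x"
  shows "- L2_inner D (\<lambda>x. b x *\<^sub>R w x) g2 \<le>
    C * (3/2 * (L2_norm D g2)\<^sup>2 + (L2_norm D g1)\<^sup>2 + 1/2 * (L2_norm D g0)\<^sup>2)"
proof -
  note int = integrable_L2_inner[OF L2(1) L2(1)] integrable_L2_inner[OF L2(2) L2(2)]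
    integrable_L2_inner[OF L2(3) L2(3)] integrable_L2_inner[OF L2_multiplier[OF b L2(4)] L2(1)]
  have "- L2_inner D (\<lambda>x. b x *\<^sub>R w x) g2 = (LINT x|lebesgue_on D. - (b x *\<^sub>R w x \<bullet> g2 x))"
    by (simp add: L2_inner_def)
  also have "\<dots> \<le> (LINT x|lebesgue_on D. C * (3/2 * (g2 x \<bullet> g2 x) + g1 x \<bullet> g1 x + 1/2 * (g0 x \<bullet> g0 x)))"
  proof (rule integral_mono_AE)
    show "AE x in lebesgue_on D. - (b x *\<^sub>R w x \<bullet> g2 x) \<le>
        C * (3/2 * (g2 x \<bullet> g2 x) + g1 x \<bullet> g1 x + 1/2 * (g0 x \<bullet> g0 x))"
      using b(2) w
    proof eventually_elim
      case (elim x)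
      let ?p = "norm (g2 x)" and ?q = "norm (g1 x)" and ?r = "norm (g0 x)"
      have "\<bar>w x \<bullet> g2 x\<bar> \<le> norm (w x) * ?p"
        by (rule Cauchy_Schwarz_ineq2)
      also have "\<dots> \<le> (2 * ?q + ?r) * ?p"
        using norm_triangle_ineq[of "2 *\<^sub>R g1 x" "(-1) *\<^sub>R g0 x"] elim(2) by (intro mult_right_mono) auto
      also have "\<dots> \<le> 3/2 * ?p\<^sup>2 + ?q\<^sup>2 + 1/2 * ?r\<^sup>2"
        using zero_le_power2[of "?q - ?p"] zero_le_power2[of "?r - ?p"]
        by (simp add: power2_eq_square algebra_simps)
      finally have inner: "\<bar>w x \<bullet> g2 x\<bar> \<le> 3/2 * ?p\<^sup>2 + ?q\<^sup>2 + 1/2 * ?r\<^sup>2" .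
      have "- (b x *\<^sub>R w x \<bullet> g2 x) \<le> \<bar>b x\<bar> * \<bar>w x \<bullet> g2 x\<bar>"
        using abs_ge_minus_self[of "b x * (w x \<bullet> g2 x)"] by (simp add: abs_mult)
      also have "\<dots> \<le> C * (3/2 * ?p\<^sup>2 + ?q\<^sup>2 + 1/2 * ?r\<^sup>2)"
        using elim(1) inner C by (intro mult_mono) auto
      finally show ?case
        by (simp add: power2_norm_eq_inner)
    qed
  qed (use int in simp_all)
  also have "\<dots> = C * (3/2 * (L2_norm D g2)\<^sup>2 + (L2_norm D g1)\<^sup>2 + 1/2 * (L2_norm D g0)\<^sup>2)"
    using int by (simp add: L2_norm_square L2_inner_def)
  finally show ?thesis .
qed

text \<open>
  The source is split by Young's inequality with the parameter \<open>\<epsilon> = \<theta> -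
  3 \<theta>p\<close>. Of the coercivity \<open>\<theta>\<close> it uses up
  \<open>\<epsilon>/2\<close>, the fluctuation uses up \<open>3/2 \<theta>p\<close>, and
  exactly \<open>\<theta>/2\<close> remains.
\<close>

lemma ensemble_energy_step:
  fixes D :: "(real^'d) set" and u v w F :: "real^'d \<Rightarrow> real"
  assumes D: "open D" "bounded D" and \<tau>: "\<tau> > 0" and \<theta>: "0 \<le> \<theta>p" "3 * \<theta>p < \<theta>"
    and H: "u \<in> H1_0 D" "v \<in> H1_0 D" "w \<in> H1_0 D"
    and am: "am \<in> borel_measurable (lebesgue_on D)" "AE x in lebesgue_on D. \<bar>am x\<bar> \<le> C"
      "AE x in lebesgue_on D. \<theta> \<le> am x"
    and b: "b \<in> borel_measurable (lebesgue_on D)" "AE x in lebesgue_on D. \<bar>b x\<bar> \<le> \<theta>p"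
    and F: "Hm1_norm D F \<le> ennreal r" "0 \<le> r"
    and eq: "L2_inner D (\<lambda>x. (3 * u x - 4 * v x + w x) / (2 * \<tau>)) u
        + L2_inner D (\<lambda>x. am x *\<^sub>R weak_grad D u x) (weak_grad D u)
        = - L2_inner D (\<lambda>x. b x *\<^sub>R weak_grad D (\<lambda>y. 2 * v y - w y) x) (weak_grad D u)
          + L2_inner D F u"
  shows "1/4 * ((L2_norm D u)\<^sup>2 + (L2_norm D (\<lambda>x. 2 * u x - v x))\<^sup>2)
      + \<tau> * (\<theta>/2 * (L2_norm D (weak_grad D u))\<^sup>2 - \<theta>p * (L2_norm D (weak_grad D v))\<^sup>2
             - \<theta>p/2 * (L2_norm D (weak_grad D w))\<^sup>2)
    \<le> 1/4 * ((L2_norm D v)\<^sup>2 + (L2_norm D (\<lambda>x. 2 * v x - w x))\<^sup>2)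
      + \<tau> / (2 * (\<theta> - 3 * \<theta>p)) * r\<^sup>2"
proof -
  note H1 = H[THEN H1_0_H1]
  note L2 = H1[THEN H1_L2] and GL2 = H1[THEN weak_grad_H1(1)]
  have ext: "(\<lambda>y. 2 * v y - w y) \<in> H1 D"
    and gext: "AE x in lebesgue_on D. weak_grad D (\<lambda>y. 2 * v y - w y) x =
      2 *\<^sub>R weak_grad D v x + (-1) *\<^sub>R weak_grad D w x"
    using H1_lincomb[OF D H1(2,3), of 2 "-1"] by simp_all
  define p where "p = L2_norm D (weak_grad D u)"
  define \<epsilon> where "\<epsilon> = \<theta> - 3 * \<theta>p"
  have \<epsilon>: "\<epsilon> > 0"
    using \<theta> by (simp add: \<epsilon>_def)
  have bdf: "1/4 * ((L2_norm D u)\<^sup>2 + (L2_norm D (\<lambda>x. 2 * u x - v x))\<^sup>2)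
       - 1/4 * ((L2_norm D v)\<^sup>2 + (L2_norm D (\<lambda>x. 2 * v x - w x))\<^sup>2)
    \<le> \<tau> * L2_inner D (\<lambda>x. (3 * u x - 4 * v x + w x) / (2 * \<tau>)) u"
    by (rule L2_inner_BDF2_ge[OF \<tau> L2])
  have co: "\<theta> * p\<^sup>2 \<le> L2_inner D (\<lambda>x. am x *\<^sub>R weak_grad D u x) (weak_grad D u)"
    unfolding p_def by (rule L2_inner_coercive[OF am GL2(1)])
  have ex: "- L2_inner D (\<lambda>x. b x *\<^sub>R weak_grad D (\<lambda>y. 2 * v y - w y) x) (weak_grad D u)
      \<le> \<theta>p * (3/2 * p\<^sup>2 + (L2_norm D (weak_grad D v))\<^sup>2 + 1/2 * (L2_norm D (weak_grad D w))\<^sup>2)"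
    unfolding p_def by (rule L2_inner_extrapolation_bound[OF b \<theta>(1) GL2 weak_grad_H1(1)[OF ext] gext])
  have "L2_inner D F u \<le> r * p"
    unfolding p_def by (rule L2_inner_le_Hm1_norm[OF D H(1) F])
  also have "\<dots> \<le> r\<^sup>2 / (2 * \<epsilon>) + \<epsilon>/2 * p\<^sup>2"
  proof -
    \<comment> \<open>Young's inequality\<close>
    have "0 \<le> (r - \<epsilon> * p)\<^sup>2 / (2 * \<epsilon>)"
      using \<epsilon> by simp
    also have "\<dots> = r\<^sup>2 / (2 * \<epsilon>) + \<epsilon>/2 * p\<^sup>2 - r * p"
      using \<epsilon> by (simp add: power2_eq_square field_simps)
    finally show ?thesis
      by simp
  qed
  finally have src: "L2_inner D F u \<le> r\<^sup>2 / (2 * \<epsilon>) + \<epsilon>/2 * p\<^sup>2" .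
  have "L2_inner D (\<lambda>x. (3 * u x - 4 * v x + w x) / (2 * \<tau>)) u \<le>
      r\<^sup>2 / (2 * \<epsilon>) - (\<theta>/2 * p\<^sup>2 - \<theta>p * (L2_norm D (weak_grad D v))\<^sup>2 - \<theta>p/2 * (L2_norm D (weak_grad D w))\<^sup>2)"
  proof -
    have "\<epsilon>/2 * p\<^sup>2 = \<theta>/2 * p\<^sup>2 - 3/2 * (\<theta>p * p\<^sup>2)" "\<theta> * p\<^sup>2 = 2 * (\<theta>/2 * p\<^sup>2)"
      "\<theta>p * (3/2 * p\<^sup>2 + (L2_norm D (weak_grad D v))\<^sup>2 + 1/2 * (L2_norm D (weak_grad D w))\<^sup>2) =
        3/2 * (\<theta>p * p\<^sup>2) + \<theta>p * (L2_norm D (weak_grad D v))\<^sup>2 + \<theta>p/2 * (L2_norm D (weak_grad D w))\<^sup>2"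
      by (simp_all add: \<epsilon>_def field_simps)
    with co ex src eq show ?thesis
      by linarith
  qed
  from mult_left_mono[OF this, of \<tau>] bdf \<tau> show ?thesis
    unfolding p_def[symmetric] \<epsilon>_def[symmetric] by (simp add: right_diff_distrib)
qed

section \<open>Energy estimate for a sample\<close>

lemma ens_mean_measurable:
  assumes "\<And>i. i \<in> {1..J} \<Longrightarrow> A i \<in> borel_measurable (lebesgue_on D)"
  shows "ens_mean J A \<in> borel_measurable (lebesgue_on D)"
  unfolding ens_mean_def[abs_def] using assms
  by (intro borel_measurable_times borel_measurable_const borel_measurable_sum)

text \<open>
  The lower bound is inherited by the average. For the upper bound a crude constant suffices,
  because it serves to guarantee integrability.
\<close>

lemma ens_mean_bounds_AE:
  assumes J: "J \<ge> 1" and lower: "\<And>i. i \<in> {1..J} \<Longrightarrow> AE x in M. \<theta> \<le> A i x"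
    and upper: "\<And>i. i \<in> {1..J} \<Longrightarrow> AE x in M. \<bar>A i x\<bar> \<le> C i"
  shows "AE x in M. \<theta> \<le> ens_mean J A x"
    and "AE x in M. \<bar>ens_mean J A x\<bar> \<le> (\<Sum>i=1..J. C i)"
proof -
  have "AE x in M. \<forall>i\<in>{1..J}. \<theta> \<le> A i x"
    using lower by (simp add: AE_ball_countable countable_finite)
  then show "AE x in M. \<theta> \<le> ens_mean J A x"
  proof eventually_elim
    case (elim x)
    then have "(\<Sum>i=1..J. \<theta>) \<le> (\<Sum>i=1..J. A i x)"
      by (intro sum_mono) auto
    then show ?case
      using J by (simp add: ens_mean_def field_simps)
  qed
  have "AE x in M. \<forall>i\<in>{1..J}. \<bar>A i x\<bar> \<le> C i"
    using upper by (simp add: AE_ball_countable countable_finite)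
  then show "AE x in M. \<bar>ens_mean J A x\<bar> \<le> (\<Sum>i=1..J. C i)"
  proof eventually_elim
    case (elim x)
    have "\<bar>ens_mean J A x\<bar> = (1 / real J) * \<bar>\<Sum>i=1..J. A i x\<bar>"
      by (simp add: ens_mean_def abs_mult)
    also have "\<dots> \<le> 1 * \<bar>\<Sum>i=1..J. A i x\<bar>"
      using J by (intro mult_right_mono) auto
    also have "\<dots> \<le> (\<Sum>i=1..J. C i)"
      using elim by (auto intro!: order_trans[OF sum_abs] sum_mono)
    finally show ?case .
  qed
qed

lemma ensemble_stability_real:
  fixes D :: "(real^'d) set"
  assumes D: "open D" "bounded D" and V: "V \<subseteq> H1_0 D" and \<tau>: "\<tau> > 0" and \<theta>: "0 \<le> \<theta>p" "3 * \<theta>p < \<theta>"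
    and N: "N \<ge> 1" and J: "j \<in> {1..J}"
    and A: "\<And>i. i \<in> {1..J} \<Longrightarrow> A i \<in> borel_measurable (lebesgue_on D)"
      "\<And>i. i \<in> {1..J} \<Longrightarrow> AE x in lebesgue_on D. \<theta> \<le> A i x"
      "\<And>i. i \<in> {1..J} \<Longrightarrow> AE x in lebesgue_on D. \<bar>A i x\<bar> \<le> C i"
    and fluct: "AE x in lebesgue_on D. \<bar>A j x - ens_mean J A x\<bar> \<le> \<theta>p"
    and sol: "ensemble_solution D V \<tau> N J A F U"
    and F: "\<And>n. n \<in> {1..N - 1} \<Longrightarrow> Hm1_norm D (F j (n + 1)) \<le> ennreal (r n)" "\<And>n. 0 \<le> r n"
  shows "1/4 * (L2_norm D (U j N))\<^sup>2 + 1/4 * (L2_norm D (\<lambda>x. 2 * U j N x - U j (N - 1) x))\<^sup>2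
      + \<theta>/2 * \<tau> * (L2_norm D (weak_grad D (U j N)))\<^sup>2
      + (\<theta>/3 - \<theta>p) * \<tau> * (\<Sum>n=1..N - 1. (L2_norm D (weak_grad D (U j n)))\<^sup>2)
    \<le> \<tau> / (2 * (\<theta> - 3 * \<theta>p)) * (\<Sum>n=1..N - 1. (r n)\<^sup>2)
      + 1/4 * (L2_norm D (U j 1))\<^sup>2 + 1/4 * (L2_norm D (\<lambda>x. 2 * U j 1 x - U j 0 x))\<^sup>2
      + \<theta>/2 * \<tau> * (L2_norm D (weak_grad D (U j 1)))\<^sup>2
      + \<theta>/6 * \<tau> * (L2_norm D (weak_grad D (U j 0)))\<^sup>2"
proof -
  define E where "E n = 1/4 * ((L2_norm D (U j n))\<^sup>2 + (L2_norm D (\<lambda>x. 2 * U j n x - U j (n - 1) x))\<^sup>2)" for n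
  define G where "G n = (L2_norm D (weak_grad D (U j n)))\<^sup>2" for n
  define R where "R n = \<tau> / (2 * (\<theta> - 3 * \<theta>p)) * (r n)\<^sup>2" for n
  have J1: "J \<ge> 1"
    using J by simp
  have UV: "U j n \<in> H1_0 D" if "n \<le> N" for n
    using sol J V that unfolding ensemble_solution_def by blast
  note mean = ens_mean_measurable[OF A(1)] ens_mean_bounds_AE(2)[OF J1 A(2,3)] ens_mean_bounds_AE(1)[OF J1 A(2,3)]
  have b: "(\<lambda>x. A j x - ens_mean J A x) \<in> borel_measurable (lebesgue_on D)"
    using A(1)[OF J] mean(1) by (rule borel_measurable_diff)
  have "E (n + 1) + \<tau> * (\<theta>/2 * G (n + 1) - \<theta>p * G n - \<theta>p/2 * G (n - 1)) \<le> E n + R n"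
    if n: "1 \<le> n" "n < N" for n
  proof -
    have "U j (n + 1) \<in> V"
      using sol J n unfolding ensemble_solution_def by simp
    with sol J n have eq: "L2_inner D (\<lambda>x. (3 * U j (n+1) x - 4 * U j n x + U j (n-1) x) / (2 * \<tau>)) (U j (n + 1))
        + L2_inner D (\<lambda>x. ens_mean J A x *\<^sub>R weak_grad D (U j (n+1)) x) (weak_grad D (U j (n + 1)))
        = - L2_inner D (\<lambda>x. (A j x - ens_mean J A x) *\<^sub>R
                weak_grad D (\<lambda>y. 2 * U j n y - U j (n-1) y) x) (weak_grad D (U j (n + 1)))
          + L2_inner D (F j (n+1)) (U j (n + 1))"
      unfolding ensemble_solution_def by simp
    have "Hm1_norm D (F j (n + 1)) \<le> ennreal (r n)"
      using n by (intro F(1)) auto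
    from ensemble_energy_step[OF D \<tau> \<theta> UV UV UV mean b fluct this F(2) eq] n
    show ?thesis
      unfolding E_def G_def R_def by simp
  qed
  from BDF2_recursion[of \<theta>p \<theta> \<tau> G N E R, OF _ _ _ this N order_refl]
  have "E N + \<tau> * (\<theta>/2 * G N + \<theta>/6 * G (N - 1)) + (\<theta>/3 - \<theta>p) * \<tau> * (\<Sum>n=1..N - 1. G n) \<le>
      (\<Sum>n=1..N - 1. R n) + E 1 + \<tau> * (\<theta>/2 * G 1 + \<theta>/6 * G 0)"
    using \<theta> \<tau> by (simp add: G_def)
  moreover have "\<tau> * (\<theta>/6 * G (N - 1)) \<ge> 0"
    using \<theta> \<tau> by (auto simp: G_def intro!: mult_nonneg_nonneg)
  moreover have "(\<Sum>n=1..N - 1. R n) = \<tau> / (2 * (\<theta> - 3 * \<theta>p)) * (\<Sum>n=1..N - 1. (r n)\<^sup>2)"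
    unfolding R_def by (rule sum_distrib_left[symmetric])
  moreover have "E N = 1/4 * (L2_norm D (U j N))\<^sup>2 + 1/4 * (L2_norm D (\<lambda>x. 2 * U j N x - U j (N - 1) x))\<^sup>2"
    "E 1 = 1/4 * (L2_norm D (U j 1))\<^sup>2 + 1/4 * (L2_norm D (\<lambda>x. 2 * U j 1 x - U j 0 x))\<^sup>2"
    unfolding E_def by simp_all
  moreover have "\<tau> * (\<theta>/2 * G N + \<theta>/6 * G (N - 1)) = \<theta>/2 * \<tau> * G N + \<tau> * (\<theta>/6 * G (N - 1))"
    "\<tau> * (\<theta>/2 * G 1 + \<theta>/6 * G 0) = \<theta>/2 * \<tau> * G 1 + \<theta>/6 * \<tau> * G 0"
    by (simp_all add: algebra_simps)
  ultimately show ?thesis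
    unfolding G_def by linarith
qed

text \<open>
  The dual norms of the source may be infinite, in which case the right-hand side is infinite
  because the factor in front of them is positive.
\<close>

lemma ensemble_stability_ennreal:
  fixes D :: "(real^'d) set"
  assumes D: "open D" "bounded D" and V: "V \<subseteq> H1_0 D" and \<tau>: "\<tau> > 0" and \<theta>: "0 \<le> \<theta>p" "3 * \<theta>p < \<theta>"
    and N: "N \<ge> 1" and J: "j \<in> {1..J}"
    and A: "\<And>i. i \<in> {1..J} \<Longrightarrow> A i \<in> borel_measurable (lebesgue_on D)"
      "\<And>i. i \<in> {1..J} \<Longrightarrow> AE x in lebesgue_on D. \<theta> \<le> A i x"
      "\<And>i. i \<in> {1..J} \<Longrightarrow> AE x in lebesgue_on D. \<bar>A i x\<bar> \<le> C i"
    and fluct: "AE x in lebesgue_on D. \<bar>A j x - ens_mean J A x\<bar> \<le> \<theta>p"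
    and sol: "ensemble_solution D V \<tau> N J A F U"
  shows "ennreal (1/4) * ennreal ((L2_norm D (U j N))\<^sup>2)
      + ennreal (1/4) * ennreal ((L2_norm D (\<lambda>x. 2 * U j N x - U j (N - 1) x))\<^sup>2)
      + ennreal (\<theta>/2 * \<tau>) * ennreal ((L2_norm D (weak_grad D (U j N)))\<^sup>2)
      + ennreal ((\<theta>/3 - \<theta>p) * \<tau>) * (\<Sum>n=1..N - 1. ennreal ((L2_norm D (weak_grad D (U j n)))\<^sup>2))
    \<le> ennreal (\<tau> / (2 * (\<theta> - 3 * \<theta>p))) * (\<Sum>n=1..N - 1. (Hm1_norm D (F j (n + 1)))\<^sup>2)
      + ennreal (1/4) * ennreal ((L2_norm D (U j 1))\<^sup>2)
      + ennreal (1/4) * ennreal ((L2_norm D (\<lambda>x. 2 * U j 1 x - U j 0 x))\<^sup>2)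
      + ennreal (\<theta>/2 * \<tau>) * ennreal ((L2_norm D (weak_grad D (U j 1)))\<^sup>2)
      + ennreal (\<theta>/6 * \<tau>) * ennreal ((L2_norm D (weak_grad D (U j 0)))\<^sup>2)"
    (is "?lhs \<le> ?c * ?S + ?a + ?b + ?d + ?e")
proof (cases "\<forall>n\<in>{1..N - 1}. Hm1_norm D (F j (n + 1)) < \<infinity>")
  case True
  define r where "r n = enn2real (Hm1_norm D (F j (n + 1)))" for n
  have r: "Hm1_norm D (F j (n + 1)) = ennreal (r n)" if "n \<in> {1..N - 1}" for n
    using True that by (simp add: r_def)
  have S: "?S = ennreal (\<Sum>n=1..N - 1. (r n)\<^sup>2)"
  proof -
    have "(Hm1_norm D (F j (n + 1)))\<^sup>2 = ennreal ((r n)\<^sup>2)" if "n \<in> {1..N - 1}" for n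
      unfolding r[OF that] by (rule ennreal_power) (simp add: r_def)
    then have "?S = (\<Sum>n=1..N - 1. ennreal ((r n)\<^sup>2))"
      by (intro sum.cong refl)
    then show ?thesis
      by (simp add: sum_ennreal)
  qed
  have "1/4 * (L2_norm D (U j N))\<^sup>2 + 1/4 * (L2_norm D (\<lambda>x. 2 * U j N x - U j (N - 1) x))\<^sup>2
      + \<theta>/2 * \<tau> * (L2_norm D (weak_grad D (U j N)))\<^sup>2
      + (\<theta>/3 - \<theta>p) * \<tau> * (\<Sum>n=1..N - 1. (L2_norm D (weak_grad D (U j n)))\<^sup>2)
    \<le> \<tau> / (2 * (\<theta> - 3 * \<theta>p)) * (\<Sum>n=1..N - 1. (r n)\<^sup>2)
      + 1/4 * (L2_norm D (U j 1))\<^sup>2 + 1/4 * (L2_norm D (\<lambda>x. 2 * U j 1 x - U j 0 x))\<^sup>2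
      + \<theta>/2 * \<tau> * (L2_norm D (weak_grad D (U j 1)))\<^sup>2
      + \<theta>/6 * \<tau> * (L2_norm D (weak_grad D (U j 0)))\<^sup>2"
    (is "?l \<le> ?r")
    by (rule ensemble_stability_real[OF D V \<tau> \<theta> N J A fluct sol]) (use r in \<open>auto simp: r_def\<close>)
  then have "ennreal ?l \<le> ennreal ?r"
    by (rule ennreal_leI)
  moreover have "?lhs = ennreal ?l"
    using \<theta> \<tau> by (simp add: sum_ennreal sum_nonneg flip: ennreal_mult ennreal_plus)
  moreover have "?c * ?S + ?a + ?b + ?d + ?e = ennreal ?r"
    unfolding S using \<theta> \<tau> by (simp add: sum_nonneg flip: ennreal_mult ennreal_plus)
  ultimately show ?thesis
    by simp
next
  case False
  then obtain n where n: "n \<in> {1..N - 1}" "\<not> Hm1_norm D (F j (n + 1)) < \<infinity>"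
    by blast
  have "(Hm1_norm D (F j (n + 1)))\<^sup>2 \<le> ?S"
    using n(1) by (intro member_le_sum) auto
  moreover have "(Hm1_norm D (F j (n + 1)))\<^sup>2 = \<top>"
    using n(2) by (simp add: not_less top_unique)
  ultimately have "?S = \<top>"
    by (simp only: top_unique)
  moreover have "?c \<noteq> 0"
    using \<theta> \<tau> by simp
  ultimately have "?c * ?S = \<top>"
    by (simp only: ennreal_mult_top if_False)
  then have "?lhs \<le> ?c * ?S"
    by (simp only: top_greatest)
  also have "\<dots> \<le> ?c * ?S + (?a + ?b + ?d + ?e)"
    by (rule add_increasing2[OF zero_le order_refl])
  finally show ?thesis
    by (simp only: add.assoc)
qed

lemma Linf_norm_finite_AE:
  assumes "Linf_norm D g < \<infinity>"
  shows "\<exists>C. AE x in lebesgue_on D. \<bar>g x\<bar> \<le> C"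
proof -
  obtain c where c: "Linf_norm D g = ennreal c" "0 \<le> c"
    using assms by (cases "Linf_norm D g") auto
  have "AE x in lebesgue_on D. \<bar>g x\<bar> \<le> c"
    using esssup_AE[of "\<lambda>x. ennreal \<bar>g x\<bar>" "lebesgue_on D"] c
    unfolding Linf_norm_def by (simp add: ennreal_le_iff)
  then show ?thesis ..
qed

lemma Linf_norm_le_AE:
  assumes "Linf_norm D g \<le> ennreal c" "0 \<le> c"
  shows "AE x in lebesgue_on D. \<bar>g x\<bar> \<le> c"
  using esssup_AE[of "\<lambda>x. ennreal \<bar>g x\<bar>" "lebesgue_on D"]
proof eventually_elim
  case (elim x)
  then have "ennreal \<bar>g x\<bar> \<le> ennreal c"
    using assms(1) unfolding Linf_norm_def by (rule order_trans)
  then show ?case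
    using assms(2) by (simp add: ennreal_le_iff)
qed

text \<open>
  The sum over the time steps comes first, so that both sides of the energy estimate have this
  shape.
\<close>

lemma Expect_lincomb_sum:
  assumes [measurable]: "X1 \<in> borel_measurable Q" "X2 \<in> borel_measurable Q" "X3 \<in> borel_measurable Q" "X4 \<in> borel_measurable Q"
    and Y: "\<And>n. n \<in> I \<Longrightarrow> Y n \<in> borel_measurable Q"
  shows "Expect Q (\<lambda>s. c0 * (\<Sum>n\<in>I. Y n s) + c1 * X1 s + c2 * X2 s + c3 * X3 s + c4 * X4 s) =
    c0 * (\<Sum>n\<in>I. Expect Q (Y n)) + c1 * Expect Q X1 + c2 * Expect Q X2 + c3 * Expect Q X3 + c4 * Expect Q X4"
proof -
  have [measurable]: "(\<lambda>s. \<Sum>n\<in>I. Y n s) \<in> borel_measurable Q"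
    using Y by (rule borel_measurable_sum)
  show ?thesis
    unfolding Expect_def by (simp add: nn_integral_add nn_integral_cmult nn_integral_sum Y)
qed

section \<open>Stability in expectation\<close>

theorem theorem4p1:
  fixes D :: "(real^'d) set" and T :: real
    and M :: "'w measure" and Q :: "'s measure"
    and a :: "'w \<Rightarrow> real^'d \<Rightarrow> real"
    and f :: "'w \<Rightarrow> real^'d \<Rightarrow> real \<Rightarrow> real"
    and L m l :: nat and \<T> :: "nat \<Rightarrow> (real^'d) set set"
    and N J :: "nat \<Rightarrow> nat" and \<Delta>t :: "nat \<Rightarrow> real"
    and \<xi> :: "nat \<Rightarrow> nat \<Rightarrow> 's \<Rightarrow> 'w"
    and U :: "nat \<Rightarrow> nat \<Rightarrow> 's \<Rightarrow> real^'d \<Rightarrow> real"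
    and \<theta> \<theta>p :: real
  assumes domain: "polyhedral_lipschitz_domain D"
    and T: "T > 0"
    and M: "prob_space M" "complete_measure M"
    and a: "random_coefficient M D a"
    and f: "random_source M D T f"
    and mesh: "mesh_hierarchy D L \<T>"
    and steps: "\<And>k. k \<le> L \<Longrightarrow> N k \<ge> 1" "\<And>k. \<Delta>t k = T / real (N k)"
    and Q: "prob_space Q"
    and samples: "\<And>k. k \<le> L \<Longrightarrow> J k \<ge> 1" "\<And>k. k \<le> L \<Longrightarrow> iid_samples Q M (J k) (\<xi> k)"
    and l: "l \<le> L"
    and U_random: "\<And>j n. j \<in> {1..J l} \<Longrightarrow> n \<le> N l \<Longrightarrow>
       (\<lambda>(s, x). U j n s x) \<in> borel_measurable (Q \<Otimes>\<^sub>M restrict_space borel D)"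
    and scheme: "AE s in Q. ensemble_solution D (fe_space D (\<T> l) m) (\<Delta>t l) (N l) (J l)
       (\<lambda>j. a (\<xi> l j s)) (\<lambda>j n x. f (\<xi> l j s) x (real n * \<Delta>t l)) (\<lambda>j n. U j n s)"
    and i: "\<theta> > 0" "measure M {\<omega> \<in> space M. min_greater \<theta> (a \<omega>) (closure D)} = 1"
    and ii: "\<theta>p > 0" "\<And>k j. k \<le> L \<Longrightarrow> j \<in> {1..J k} \<Longrightarrow>
       measure Q {s \<in> space Q. Linf_norm D (\<lambda>x. a (\<xi> k j s) x - ens_mean (J k) (\<lambda>i. a (\<xi> k i s)) x)
          \<le> ennreal \<theta>p} = 1"
    and stability_condition: "\<theta> > 3 * \<theta>p"
  shows "\<forall>j \<in> {1..J l}.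
      ennreal (1/4) * Expect Q (\<lambda>s. (L2_norm D (U j (N l) s))\<^sup>2)
    + ennreal (1/4) * Expect Q (\<lambda>s. (L2_norm D (\<lambda>x. 2 * U j (N l) s x - U j (N l - 1) s x))\<^sup>2)
    + ennreal (\<theta>/2 * \<Delta>t l) * Expect Q (\<lambda>s. (L2_norm D (weak_grad D (U j (N l) s)))\<^sup>2)
    + ennreal ((\<theta>/3 - \<theta>p) * \<Delta>t l) *
        (\<Sum>n=1..N l - 1. Expect Q (\<lambda>s. (L2_norm D (weak_grad D (U j n s)))\<^sup>2))
    \<le> ennreal (\<Delta>t l / (2 * (\<theta> - 3 * \<theta>p))) *
        (\<Sum>n=1..N l - 1. Expect Q (\<lambda>s. (Hm1_norm D (\<lambda>x. f (\<xi> l j s) x (real (n+1) * \<Delta>t l)))\<^sup>2))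
    + ennreal (1/4) * Expect Q (\<lambda>s. (L2_norm D (U j 1 s))\<^sup>2)
    + ennreal (1/4) * Expect Q (\<lambda>s. (L2_norm D (\<lambda>x. 2 * U j 1 s x - U j 0 s x))\<^sup>2)
    + ennreal (\<theta>/2 * \<Delta>t l) * Expect Q (\<lambda>s. (L2_norm D (weak_grad D (U j 1 s)))\<^sup>2)
    + ennreal (\<theta>/6 * \<Delta>t l) * Expect Q (\<lambda>s. (L2_norm D (weak_grad D (U j 0 s)))\<^sup>2)"
proof
  fix j assume j: "j \<in> {1..J l}"
  interpret M: prob_space M by (rule M(1))
  interpret Q: prob_space Q by (rule Q)
  let ?V = "fe_space D (\<T> l) m" and ?\<tau> = "\<Delta>t l" and ?N = "N l"
  have D: "open D" "bounded D"
    using domain by (auto simp: polyhedral_lipschitz_domain_def lipschitz_domain_def)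
  have "simplicial_mesh D (\<T> l)"
    using mesh l by (simp add: mesh_hierarchy_def)
  then have \<T>: "finite (\<T> l)" "D \<subseteq> \<Union>(\<T> l)"
    using closure_subset[of D] by (simp_all add: simplicial_mesh_def triangulation_def)
  have N: "?N \<ge> 1"
    using steps(1) l by blast
  have \<tau>: "?\<tau> > 0"
    using T N by (simp add: steps(2))
  have \<theta>: "0 \<le> \<theta>p" "3 * \<theta>p < \<theta>"
    using ii(1) stability_condition by simp_all
  have V: "?V \<subseteq> H1_0 D"
    by (auto simp: fe_space_def)
  have \<xi>: "\<xi> l i \<in> measurable Q M" "distr Q M (\<xi> l i) = M" if "i \<in> {1..J l}" for i
    using samples(2)[OF l] that by (auto simp: iid_samples_def Q.indep_vars_def)
  have sample_AE: "AE s in Q. P (\<xi> l i s)" if "i \<in> {1..J l}" "AE \<omega> in M. P \<omega>" for i P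
  proof (rule AE_distrD[OF \<xi>(1)[OF that(1)]])
    show "AE \<omega> in distr Q M (\<xi> l i). P \<omega>"
      unfolding \<xi>(2)[OF that(1)] by (rule that(2))
  qed

  \<comment> \<open>properties of almost every \<open>\<omega>\<close> pass to the samples, because these have the law \<open>M\<close>\<close>
  have "AE \<omega> in M. min_greater \<theta> (a \<omega>) (closure D)"
    using M.AE_prob_1[OF i(2)] by eventually_elim simp
  then have M_lower: "AE \<omega> in M. \<forall>x\<in>D. \<theta> \<le> a \<omega> x"
  proof eventually_elim
    case (elim \<omega>)
    then show ?case
      using closure_subset[of D] unfolding min_greater_def by force
  qed
  have "AE s in Q. \<forall>x\<in>D. \<theta> \<le> a (\<xi> l i s) x" if "i \<in> {1..J l}" for i
    by (rule sample_AE[OF that M_lower])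
  then have lower: "AE s in Q. \<forall>i\<in>{1..J l}. \<forall>x\<in>D. \<theta> \<le> a (\<xi> l i s) x"
    by (simp add: AE_ball_countable countable_finite)
  have M_upper: "AE \<omega> in M. Linf_norm D (a \<omega>) < \<infinity>"
    using a by (simp add: random_coefficient_def)
  have "AE s in Q. Linf_norm D (a (\<xi> l i s)) < \<infinity>" if "i \<in> {1..J l}" for i
    by (rule sample_AE[OF that M_upper])
  then have upper: "AE s in Q. \<forall>i\<in>{1..J l}. Linf_norm D (a (\<xi> l i s)) < \<infinity>"
    by (simp add: AE_ball_countable countable_finite)
  have fluct: "AE s in Q. Linf_norm D (\<lambda>x. a (\<xi> l j s) x - ens_mean (J l) (\<lambda>i. a (\<xi> l i s)) x) \<le> ennreal \<theta>p"
    using Q.AE_prob_1[OF ii(2)[OF l j]] by eventually_elim simp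
  have a_meas: "a \<omega> \<in> borel_measurable (lebesgue_on D)" if "\<omega> \<in> space M" for \<omega>
  proof (rule borel_measurable_lebesgue_on[OF D(1)])
    have "(\<lambda>(\<omega>, x). a \<omega> x) \<in> borel_measurable (M \<Otimes>\<^sub>M restrict_space borel D)"
      using a by (simp add: random_coefficient_def)
    from measurable_compose[OF measurable_Pair1'[OF that] this] show "a \<omega> \<in> borel_measurable (restrict_space borel D)"
      by simp
  qed

  let ?P = "\<lambda>n s. ennreal ((L2_norm D (U j n s))\<^sup>2)"
  let ?S = "\<lambda>n s. ennreal ((L2_norm D (\<lambda>x. 2 * U j n s x - U j (n - 1) s x))\<^sup>2)"
  let ?G = "\<lambda>n s. ennreal ((L2_norm D (weak_grad D (U j n s)))\<^sup>2)"
  let ?H = "\<lambda>n s. (Hm1_norm D (\<lambda>x. f (\<xi> l j s) x (real (n + 1) * ?\<tau>)))\<^sup>2"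
  let ?cE = "ennreal (1/4)" and ?cN = "ennreal (\<theta>/2 * ?\<tau>)" and ?cS = "ennreal ((\<theta>/3 - \<theta>p) * ?\<tau>)"
    and ?cF = "ennreal (?\<tau> / (2 * (\<theta> - 3 * \<theta>p)))" and ?cI = "ennreal (\<theta>/6 * ?\<tau>)"

  have path: "AE s in Q. ?cE * ?P ?N s + ?cE * ?S ?N s + ?cN * ?G ?N s + ?cS * (\<Sum>n=1..?N - 1. ?G n s)
      \<le> ?cF * (\<Sum>n=1..?N - 1. ?H n s) + ?cE * ?P 1 s + ?cE * ?S 1 s + ?cN * ?G 1 s + ?cI * ?G 0 s"
    using lower upper fluct scheme AE_space
  proof eventually_elim
    case (elim s)
    have "\<forall>i\<in>{1..J l}. \<exists>C. AE x in lebesgue_on D. \<bar>a (\<xi> l i s) x\<bar> \<le> C"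
      using elim(2) Linf_norm_finite_AE by blast
    from bchoice[OF this] obtain C where
      C: "\<forall>i\<in>{1..J l}. AE x in lebesgue_on D. \<bar>a (\<xi> l i s) x\<bar> \<le> C i" ..
    have meas: "a (\<xi> l i s) \<in> borel_measurable (lebesgue_on D)" if "i \<in> {1..J l}" for i
      by (rule a_meas[OF measurable_space[OF \<xi>(1)[OF that] elim(5)]])
    have low: "AE x in lebesgue_on D. \<theta> \<le> a (\<xi> l i s) x" if "i \<in> {1..J l}" for i
      using elim(1) that by (intro AE_I2) simp
    have up: "AE x in lebesgue_on D. \<bar>a (\<xi> l i s) x\<bar> \<le> C i" if "i \<in> {1..J l}" for i
      using C that by blast
    have "?cE * ?P ?N s + ?cE * ?S ?N s + ?cN * ?G ?N s + ?cS * (\<Sum>n=1..?N - 1. ?G n s)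
      \<le> ?cF * (\<Sum>n=1..?N - 1. ?H n s) + ?cE * ?P 1 s +
        ?cE * ennreal ((L2_norm D (\<lambda>x. 2 * U j 1 s x - U j 0 s x))\<^sup>2) + ?cN * ?G 1 s + ?cI * ?G 0 s"
      by (rule ensemble_stability_ennreal[OF D V \<tau> \<theta> N j meas low up Linf_norm_le_AE[OF elim(3) \<theta>(1)] elim(4)])
    then show ?case
      by simp
  qed

  have U_meas: "(\<lambda>(s, x). U j n s x) \<in> borel_measurable (Q \<Otimes>\<^sub>M restrict_space borel D)" if "n \<le> ?N" for n
    by (rule U_random[OF j that])
  have P_meas: "?P n \<in> borel_measurable Q" if "n \<le> ?N" for n
    using measurable_L2_norm_square[OF D U_meas[OF that]] by simp
  have S_meas: "?S n \<in> borel_measurable Q" if "n \<le> ?N" for n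
  proof -
    have "(\<lambda>(s, x). 2 * U j n s x - U j (n - 1) s x) \<in> borel_measurable (Q \<Otimes>\<^sub>M restrict_space borel D)"
      using U_meas[of n] U_meas[of "n - 1"] that by (simp add: split_beta)
    from measurable_L2_norm_square[OF D this] show ?thesis
      by simp
  qed
  have "\<forall>n\<in>{..?N}. \<exists>g. g \<in> borel_measurable Q \<and>
      (\<forall>s. U j n s \<in> piecewise_poly_H1 D (\<T> l) m \<longrightarrow> (L2_norm D (weak_grad D (U j n s)))\<^sup>2 = g s)"
    using measurable_gradient_norm_square[OF D \<T> U_meas] by (simp add: Bex_def)
  from bchoice[OF this] obtain g where
    g: "\<forall>n\<in>{..?N}. g n \<in> borel_measurable Q \<and>
      (\<forall>s. U j n s \<in> piecewise_poly_H1 D (\<T> l) m \<longrightarrow> (L2_norm D (weak_grad D (U j n s)))\<^sup>2 = g n s)" ..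
  let ?g = "\<lambda>n s. ennreal (g n s)"
  have g_meas: "?g n \<in> borel_measurable Q" if "n \<le> ?N" for n
  proof -
    have "g n \<in> borel_measurable Q"
      using g that by simp
    then show ?thesis
      by measurable
  qed
  have G_eq: "AE s in Q. \<forall>n\<in>{..?N}. ?G n s = ?g n s"
    using scheme
  proof eventually_elim
    case (elim s)
    have "U j n s \<in> piecewise_poly_H1 D (\<T> l) m" if "n \<le> ?N" for n
      using elim j that fe_space_subset unfolding ensemble_solution_def by blast
    then show ?case
      using g by simp
  qed
  have G_Expect: "Expect Q (?G n) = Expect Q (?g n)" if "n \<le> ?N" for n
    unfolding Expect_def using G_eq that by (intro nn_integral_cong_AE) (auto elim!: eventually_mono)
  have G_sum: "(\<Sum>n=1..?N - 1. Expect Q (?G n)) = (\<Sum>n=1..?N - 1. Expect Q (?g n))"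
    by (intro sum.cong refl G_Expect) auto
  have H_meas: "?H n \<in> borel_measurable Q" if n: "n \<in> {1..?N - 1}" for n
  proof -
    have "real (n + 1) * ?\<tau> \<le> real ?N * ?\<tau>"
      using n \<tau> by (intro mult_right_mono) auto
    then have "real (n + 1) * ?\<tau> \<in> {0..T}"
      using N T by (simp add: steps(2))
    then have t: "real (n + 1) * ?\<tau> \<in> space (restrict_space borel {0..T})"
      by (simp add: space_restrict_space)
    have "(\<lambda>(\<omega>, t). Hm1_norm D (\<lambda>x. f \<omega> x t)) \<in> borel_measurable (M \<Otimes>\<^sub>M restrict_space borel {0..T})"
      using f by (simp add: random_source_def)
    from measurable_compose[OF measurable_Pair2'[OF t] this]
    have "(\<lambda>\<omega>. Hm1_norm D (\<lambda>x. f \<omega> x (real (n + 1) * ?\<tau>))) \<in> borel_measurable M"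
      by simp
    from measurable_compose[OF \<xi>(1)[OF j] this] show ?thesis
      by simp
  qed

  \<comment> \<open>expectations are additive for the measurable versions \<open>g\<close>; a summand with the factor \<open>0\<close> gives the left-hand side as many terms as the right-hand side\<close>
  have "?cE * Expect Q (?P ?N) + ?cE * Expect Q (?S ?N) + ?cN * Expect Q (?G ?N)
      + ?cS * (\<Sum>n=1..?N - 1. Expect Q (?G n)) =
      ?cS * (\<Sum>n=1..?N - 1. Expect Q (?g n)) + ?cE * Expect Q (?P ?N) + ?cE * Expect Q (?S ?N)
      + ?cN * Expect Q (?g ?N) + 0 * Expect Q (?P ?N)"
    unfolding G_sum G_Expect[OF order_refl] by (simp only: mult_zero_left add_0_left add_0_right add_ac)
  also have "\<dots> = Expect Q (\<lambda>s. ?cS * (\<Sum>n=1..?N - 1. ?g n s) + ?cE * ?P ?N s + ?cE * ?S ?N s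
      + ?cN * ?g ?N s + 0 * ?P ?N s)"
    by (intro Expect_lincomb_sum[symmetric] P_meas S_meas g_meas) auto
  also have "\<dots> \<le> Expect Q (\<lambda>s. ?cF * (\<Sum>n=1..?N - 1. ?H n s) + ?cE * ?P 1 s + ?cE * ?S 1 s
      + ?cN * ?g 1 s + ?cI * ?g 0 s)"
    unfolding Expect_def
  proof (rule nn_integral_mono_AE)
    show "AE s in Q. ?cS * (\<Sum>n=1..?N - 1. ?g n s) + ?cE * ?P ?N s + ?cE * ?S ?N s
        + ?cN * ?g ?N s + 0 * ?P ?N s
      \<le> ?cF * (\<Sum>n=1..?N - 1. ?H n s) + ?cE * ?P 1 s + ?cE * ?S 1 s + ?cN * ?g 1 s + ?cI * ?g 0 s"
      using path G_eq
    proof eventually_elim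
      case (elim s)
      have eq: "?g n s = ?G n s" if "n \<le> ?N" for n
        using elim(2) that by simp
      have sum_eq: "(\<Sum>n=1..?N - 1. ?g n s) = (\<Sum>n=1..?N - 1. ?G n s)"
        by (intro sum.cong refl eq) auto
      show ?case
        unfolding sum_eq eq[OF order_refl] eq[OF N] eq[OF le0] using elim(1) by (simp only: mult_zero_left add_0_left add_0_right add_ac)
    qed
  qed
  also have "\<dots> = ?cF * (\<Sum>n=1..?N - 1. Expect Q (?H n)) + ?cE * Expect Q (?P 1) + ?cE * Expect Q (?S 1)
      + ?cN * Expect Q (?g 1) + ?cI * Expect Q (?g 0)"
    using N by (intro Expect_lincomb_sum P_meas S_meas g_meas H_meas) auto
  also have "\<dots> = ?cF * (\<Sum>n=1..?N - 1. Expect Q (?H n)) + ?cE * Expect Q (?P 1)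
      + ?cE * Expect Q (\<lambda>s. ennreal ((L2_norm D (\<lambda>x. 2 * U j 1 s x - U j 0 s x))\<^sup>2))
      + ?cN * Expect Q (?G 1) + ?cI * Expect Q (?G 0)"
    using N by (simp add: G_Expect)
  finally show "?cE * Expect Q (?P ?N) + ?cE * Expect Q (?S ?N) + ?cN * Expect Q (?G ?N)
      + ?cS * (\<Sum>n=1..?N - 1. Expect Q (?G n)) \<le>
      ?cF * (\<Sum>n=1..?N - 1. Expect Q (?H n)) + ?cE * Expect Q (?P 1)
      + ?cE * Expect Q (\<lambda>s. ennreal ((L2_norm D (\<lambda>x. 2 * U j 1 s x - U j 0 s x))\<^sup>2))
      + ?cN * Expect Q (?G 1) + ?cI * Expect Q (?G 0)" .
qed

end
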